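(* Let $n\ge 3$. Then: $\mathrm{f}\mu^{k}(C_3\,\square\,C_n)=9$ if $k=0$ and $n\ge 6$; $\mathrm{f}\mu^{k}(C_3\,\square\,C_n)=7$ if $k=0$ and $n\in\{4,5\}$; $\mathrm{f}\mu^{k}(C_3\,\square\,C_n)=6$ if $k=0$ and $n=3$, or if $k=1$ and $n$ is even; $\mathrm{f}\mu^{k}(C_3\,\square\,C_n)=4$ if $k=1$ and $n$ is odd; $\mathrm{f}\mu^{k}(C_3\,\square\,C_n)=3$ if $k\ge 2$.
   Context: For an integer $k\ge 0$ and a connected graph $G$, a set $X\subseteq V(G)$ is a $k$-fault-tolerant mutual-visibility set ($k$-ftmv set) if for any two non-adjacent vertices $u,v\in X$ there exist $k+1$ internally vertex-disjoint shortest $u,v$-paths $Q_1,\dots,Q_{k+1}$ in $G$ such that $V(Q_i)\cap X=\{u,v\}$ for every $i$. $\mathrm{f}\mu^{k}(G)$ denotes the maximum cardinality of a $k$-ftmv set of $G$. $C_n$ is the cycle on $n$ vertices, and $G\,\square\,H$ is the Cartesian product: vertex set $V(G)\times V(H)$, with $(g,h)\sim(g',h')$ iff either $g=g'$ and $hh'\in E(H)$, or $gg'\in E(G)$ and $h=h'$. *)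

theory Defs
  imports "Graph_Theory.Graph_Theory" "Graph_Theory.Kuratowski"
begin

text \<open>
  A finite simple graph is a \<^locale>\<open>pair_graph\<close>: a vertex set together with a symmetric,
  irreflexive set of arcs, an undirected edge being represented by its two arcs.
\<close>

definition cycle_graph :: "nat \<Rightarrow> nat pair_pre_digraph" where
  "cycle_graph n = \<lparr> pverts = {..<n},
     parcs = {(i, j). i < n \<and> j < n \<and> (j = Suc i mod n \<or> i = Suc j mod n)} \<rparr>"

definition cartesian_product ::
    "'a pair_pre_digraph \<Rightarrow> 'b pair_pre_digraph \<Rightarrow> ('a \<times> 'b) pair_pre_digraph"
    (infixr \<open>\<box>\<close> 70) where
  "G \<box> H = \<lparr> pverts = pverts G \<times> pverts H,
     parcs = {((g, h), (g', h')).
       (g \<in> pverts G \<and> g = g' \<and> (h, h') \<in> parcs H) \<or>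
       ((g, g') \<in> parcs G \<and> h \<in> pverts H \<and> h = h')} \<rparr>"

context pair_pre_digraph
begin

text \<open>
  Paths are lists of arcs, so \<^const>\<open>length\<close> is the number of edges traversed.
\<close>

definition shortest_path :: "'a \<Rightarrow> ('a \<times> 'a) awalk \<Rightarrow> 'a \<Rightarrow> bool" where
  "shortest_path u p v \<longleftrightarrow> is_arg_min length (\<lambda>q. apath u q v) p"

text \<open>
  All the paths considered have the same two ends, so being internally vertex-disjoint means
  that the sets of inner vertices are disjoint.
\<close>

definition ftmv_set :: "nat \<Rightarrow> 'a set \<Rightarrow> bool" where
  "ftmv_set k X \<longleftrightarrow> X \<subseteq> pverts G \<and>
     (\<forall>u\<in>X. \<forall>v\<in>X. u \<noteq> v \<and> (u, v) \<notin> parcs G \<longrightarrow>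
       (\<exists>P. card P = k + 1 \<and>
            (\<forall>p\<in>P. shortest_path u p v \<and> set (awalk_verts u p) \<inter> X = {u, v}) \<and>
            pairwise (\<lambda>p q. set (inner_verts p) \<inter> set (inner_verts q) = {}) P))"

definition ftmv_number :: "nat \<Rightarrow> nat" where
  "ftmv_number k = Max {card X | X. ftmv_set k X}"

end

lemma pair_graph_cycle_graph:
  assumes "3 \<le> n"
  shows "pair_graph (cycle_graph n)"
proof
  show "finite (parcs (cycle_graph n))"
    by (rule finite_subset[of _ "{..<n} \<times> {..<n}"]) (auto simp: cycle_graph_def)
  show "symmetric (cycle_graph n)"
    by (auto simp: cycle_graph_def symmetric_def intro!: symI)
  show "fst e \<noteq> snd e" if "e \<in> parcs (cycle_graph n)" for e
    using that assms by (auto simp: cycle_graph_def mod_Suc split: if_splits)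
qed (auto simp: cycle_graph_def)

lemma pair_graph_cartesian_product:
  assumes "pair_graph G" "pair_graph H"
  shows "pair_graph (G \<box> H)"
proof -
  interpret G: pair_graph G by fact
  interpret H: pair_graph H by fact
  show ?thesis
  proof
    show "finite (pverts (G \<box> H))"
      by (simp add: cartesian_product_def G.pair_finite_verts H.pair_finite_verts)
    then have "finite (pverts (G \<box> H) \<times> pverts (G \<box> H))"
      by simp
    then show "finite (parcs (G \<box> H))"
      by (rule finite_subset[rotated])
        (auto simp: cartesian_product_def dest: G.wellformed' H.wellformed')
    show "symmetric (G \<box> H)"
      by (auto simp: cartesian_product_def symmetric_def
          intro!: symI dest: G.arcs_symmetric H.arcs_symmetric)
    show "fst e \<noteq> snd e" if "e \<in> parcs (G \<box> H)" for e
      using that by (auto simp: cartesian_product_def dest: G.no_loops' H.no_loops')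
  qed (auto simp: cartesian_product_def dest: G.wellformed' H.wellformed')
qed

lemma ftmv_number_attained:
  assumes "pair_graph G"
  shows "\<exists>X. pair_pre_digraph.ftmv_set G k X \<and> card X = pair_pre_digraph.ftmv_number G k"
    and "pair_pre_digraph.ftmv_set G k X \<Longrightarrow> card X \<le> pair_pre_digraph.ftmv_number G k"
proof -
  interpret pair_graph G by fact
  let ?S = "{card X | X. ftmv_set k X}"
  have "?S \<subseteq> card ` Pow (pverts G)"
    by (auto simp: ftmv_set_def)
  then have fin: "finite ?S"
    using pair_finite_verts finite_subset by blast
  have "ftmv_set k {}"
    by (simp add: ftmv_set_def)
  then have "?S \<noteq> {}"
    by blast
  with fin have "ftmv_number k \<in> ?S"
    unfolding ftmv_number_def by (rule Max_in)
  then show "\<exists>X. ftmv_set k X \<and> card X = ftmv_number k"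
    by force
  show "card X \<le> ftmv_number k" if "ftmv_set k X"
    unfolding ftmv_number_def using fin that by (intro Max_ge) auto
qed

end

theory Submission
  imports Defs
begin

text \<open>
  Write the vertices as pairs (layer, position), with three layers and cyclic positions, so that
  the distance is the cyclic distance of the positions, plus one if the layers differ. Every
  geodesic runs monotonically around the cycle and changes layer at most once.

  Upper bounds. In a \<open>k\<close>-fault-tolerant set \<open>X\<close>, some geodesic between two non-adjacent members
  still avoids \<open>X\<close> after the deletion of any \<open>k\<close> further vertices. For \<open>k = 0\<close> this forbids four points
  of \<open>X\<close> on a layer, and for \<open>n \<in> {4, 5}\<close> two layers with three points each; for \<open>n = 3\<close> two layers share
  at most one position. For \<open>k = 1\<close> two points on a layer are adjacent or antipodal, which leaves at most
  two of them if \<open>n \<ge> 4\<close>; for odd \<open>n\<close> the free rectangle spanned by two points on different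
  layers rules out a second layer with two points. For \<open>k \<ge> 2\<close> three neighbours of one end
  must lie closer to the other, so non-adjacent points are antipodal and on different layers.

  Lower bounds. Trisecting the cycle on each layer gives nine points, two antipodal triangles give
  six for \<open>k = 1\<close>, and an edge on one layer opposite to an edge across the other two gives four.
\<close>

section \<open>Distances in the torus\<close>

text \<open>Case distinctions instead of \<open>mod\<close> keep all facts about cyclic positions
  within linear arithmetic.\<close>

definition nxt :: "nat \<Rightarrow> nat \<Rightarrow> nat" where
  "nxt n a = (if Suc a = n then 0 else Suc a)"

definition prv :: "nat \<Rightarrow> nat \<Rightarrow> nat" where
  "prv n a = (if a = 0 then n - 1 else a - 1)"

definition up :: "nat \<Rightarrow> nat \<Rightarrow> nat \<Rightarrow> nat" where
  "up n a b = (if a \<le> b then b - a else b + n - a)"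

text \<open>The layer term never exceeds one because \<open>C_3\<close> is complete;
  \<open>shortest_path_iff\<close> shows that this is the length of shortest paths.\<close>

definition tdist :: "nat \<Rightarrow> nat \<times> nat \<Rightarrow> nat \<times> nat \<Rightarrow> nat" where
  "tdist n u v = (if fst u = fst v then 0 else 1) + min (up n (snd u) (snd v)) (up n (snd v) (snd u))"

section \<open>Arithmetic of cyclic offsets\<close>

lemma nxt_less: "a < n \<Longrightarrow> nxt n a < n"
  by (auto simp: nxt_def)

lemma prv_less: "a < n \<Longrightarrow> prv n a < n"
  by (auto simp: prv_def)

lemma nxt_eq_iff: "a < n \<Longrightarrow> b < n \<Longrightarrow> a = nxt n b \<longleftrightarrow> b = prv n a"
  by (auto simp: nxt_def prv_def)

lemma up_less: "a < n \<Longrightarrow> b < n \<Longrightarrow> up n a b < n"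
  by (auto simp: up_def)

lemma up_eq_0: "a < n \<Longrightarrow> b < n \<Longrightarrow> up n a b = 0 \<longleftrightarrow> a = b"
  by (auto simp: up_def)

lemma up_swap: "a < n \<Longrightarrow> b < n \<Longrightarrow> up n b a = (if a = b then 0 else n - up n a b)"
  by (auto simp: up_def)

lemma up_nxt: "a < n \<Longrightarrow> b < n \<Longrightarrow> up n (nxt n a) b = (if a = b then n - 1 else up n a b - 1)"
  by (auto simp: up_def nxt_def)

lemma up_prv:
  "a < n \<Longrightarrow> b < n \<Longrightarrow> up n (prv n a) b = (if Suc (up n a b) = n then 0 else Suc (up n a b))"
  by (auto simp: up_def prv_def)

lemma arc_cycle_graph_iff:
  "(a, b) \<in> parcs (cycle_graph n) \<longleftrightarrow> a < n \<and> b < n \<and> (b = nxt n a \<or> b = prv n a)"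
proof -
  have *: "Suc x mod n = nxt n x" if "x < n" for x
    using that by (auto simp: nxt_def)
  have "(a, b) \<in> parcs (cycle_graph n) \<longleftrightarrow>
    a < n \<and> b < n \<and> (b = Suc a mod n \<or> a = Suc b mod n)"
    by (simp add: cycle_graph_def)
  also have "\<dots> \<longleftrightarrow> a < n \<and> b < n \<and> (b = nxt n a \<or> a = nxt n b)"
    by (simp add: * cong: conj_cong)
  finally show ?thesis
    using nxt_eq_iff by blast
qed

lemma up_less_nxt: "a < n \<Longrightarrow> c < n \<Longrightarrow> up n a (nxt n c) = (if Suc (up n a c) = n then 0 else Suc (up n a c))"
  by (auto simp: up_def nxt_def)

lemma up_prv_right: "a < n \<Longrightarrow> c < n \<Longrightarrow> up n (prv n c) a = (if Suc (up n c a) = n then 0 else Suc (up n c a))"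
  by (auto simp: up_def prv_def)

lemma up_diff: "a < n \<Longrightarrow> b < n \<Longrightarrow> c < n \<Longrightarrow> up n a c \<le> up n a b \<Longrightarrow> up n c b = up n a b - up n a c"
  by (auto simp: up_def split: if_splits)

lemma up_diff': "a < n \<Longrightarrow> b < n \<Longrightarrow> c < n \<Longrightarrow> up n c a \<le> up n b a \<Longrightarrow> up n b c = up n b a - up n c a"
  by (auto simp: up_def split: if_splits)

lemma up_inj: "a < n \<Longrightarrow> b < n \<Longrightarrow> c < n \<Longrightarrow> up n a b = up n a c \<Longrightarrow> b = c"
  by (auto simp: up_def split: if_splits)

lemma up_inj': "a < n \<Longrightarrow> b < n \<Longrightarrow> c < n \<Longrightarrow> up n b a = up n c a \<Longrightarrow> b = c"
  by (auto simp: up_def split: if_splits)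

text \<open>
  A zone contains the geodesics from \<open>u\<close> to \<open>v\<close> that run in the increasing (or decreasing) direction
  of the long cycle and change layer \<open>s\<close> steps after \<open>u\<close>.
\<close>

definition zone_up :: "nat \<Rightarrow> nat \<Rightarrow> nat \<times> nat \<Rightarrow> nat \<times> nat \<Rightarrow> (nat \<times> nat) set" where
  "zone_up n s u v = {(l, c). c < n \<and> (l = fst u \<and> up n (snd u) c \<le> s \<or>
     l = fst v \<and> s \<le> up n (snd u) c \<and> up n (snd u) c \<le> up n (snd u) (snd v))}"

definition zone_down :: "nat \<Rightarrow> nat \<Rightarrow> nat \<times> nat \<Rightarrow> nat \<times> nat \<Rightarrow> (nat \<times> nat) set" where
  "zone_down n s u v = {(l, c). c < n \<and> (l = fst u \<and> up n c (snd u) \<le> s \<or>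
     l = fst v \<and> s \<le> up n c (snd u) \<and> up n c (snd u) \<le> up n (snd v) (snd u))}"

text \<open>
  Visibility inside a single zone, spelled out for the exceptional values \<open>n \<le> 5\<close>, where two vertices
  are at most two steps apart along the long cycle.
\<close>

definition visible :: "nat \<Rightarrow> (nat \<times> nat) set \<Rightarrow> nat \<times> nat \<Rightarrow> nat \<times> nat \<Rightarrow> bool" where
  "visible n X u v \<longleftrightarrow> (\<exists>s\<in>{0, 1, 2}.
     2 * up n (snd u) (snd v) \<le> n \<and> s \<le> up n (snd u) (snd v) \<and>
       (\<forall>x\<in>X. fst x = fst u \<and> up n (snd u) (snd x) \<le> s \<or>
          fst x = fst v \<and> s \<le> up n (snd u) (snd x) \<and> up n (snd u) (snd x) \<le> up n (snd u) (snd v) \<longrightarrow>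
          x = u \<or> x = v) \<or>
     2 * up n (snd v) (snd u) \<le> n \<and> s \<le> up n (snd v) (snd u) \<and>
       (\<forall>x\<in>X. fst x = fst u \<and> up n (snd x) (snd u) \<le> s \<or>
          fst x = fst v \<and> s \<le> up n (snd x) (snd u) \<and> up n (snd x) (snd u) \<le> up n (snd v) (snd u) \<longrightarrow>
          x = u \<or> x = v))"

text \<open>The points off the diagonal: any two layers share exactly one position, the most that
  the argument in \<open>ftmv_0_card_le_6\<close> allows.\<close>

lemma visible_3:
  "u \<in> X \<Longrightarrow> v \<in> X \<Longrightarrow> u \<noteq> v \<Longrightarrow> X = {(0,1), (0,2), (1,0), (1,2), (2,0), (2,1)} \<Longrightarrow> visible 3 X u v"
  by (hypsubst, (elim insertE emptyE; (hypsubst_thin, simp add: visible_def up_def)))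

text \<open>Layer sizes three, two, two are extremal here, since at most one layer can hold three
  points. The same set serves for \<open>n = 5\<close>.\<close>

lemma visible_4:
  "u \<in> X \<Longrightarrow> v \<in> X \<Longrightarrow> u \<noteq> v \<Longrightarrow> X = {(0,0), (0,1), (0,3), (1,1), (1,3), (2,1), (2,3)} \<Longrightarrow> visible 4 X u v"
  by (hypsubst, (elim insertE emptyE; (hypsubst_thin, simp add: visible_def up_def)))

lemma visible_5:
  "u \<in> X \<Longrightarrow> v \<in> X \<Longrightarrow> u \<noteq> v \<Longrightarrow> X = {(0,0), (0,1), (0,3), (1,1), (1,3), (2,1), (2,3)} \<Longrightarrow> visible 5 X u v"
  by (hypsubst, (elim insertE emptyE; (hypsubst_thin, simp add: visible_def up_def)))

lemma three_of_five:
  assumes "A \<subseteq> {..<5::nat}" "3 \<le> card A" "x < 5" "y < 5" "z < 5" "x \<noteq> y" "x \<noteq> z" "y \<noteq> z"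
  shows "x \<in> A \<or> y \<in> A \<or> z \<in> A"
proof (rule ccontr)
  assume "\<not> ?thesis"
  with assms(1) have "A \<subseteq> {..<5} - {x, y, z}" by blast
  then have "card A \<le> card ({..<5} - {x, y, z})" by (simp add: card_mono)
  also have "\<dots> = 2" using assms(3-) by (subst card_Diff_subset) auto
  finally show False using assms(2) by simp
qed

lemma three_of_four:
  assumes "A \<subseteq> {..<4::nat}" "3 \<le> card A" "x < 4" "y < 4" "x \<noteq> y"
  shows "x \<in> A \<or> y \<in> A"
proof (rule ccontr)
  assume "\<not> ?thesis"
  with assms(1) have "A \<subseteq> {..<4} - {x, y}" by blast
  then have "card A \<le> card ({..<4} - {x, y})" by (simp add: card_mono)
  also have "\<dots> = 2" using assms(3-) by (subst card_Diff_subset) auto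
  finally show False using assms(2) by simp
qed

locale torus =
  fixes n :: nat
  assumes n_ge_3: "3 \<le> n"
begin

abbreviation T :: "(nat \<times> nat) pair_pre_digraph" where
  "T \<equiv> cycle_graph 3 \<box> cycle_graph n"

sublocale pair_graph T
  using n_ge_3 by (intro pair_graph_cartesian_product pair_graph_cycle_graph) auto

lemma pverts_T: "pverts T = {..<3} \<times> {..<n}"
  by (simp add: cartesian_product_def cycle_graph_def)

lemma arc_iff:
  "((i, a), (j, b)) \<in> parcs T \<longleftrightarrow> i < 3 \<and> j < 3 \<and> a < n \<and> b < n \<and>
     (i = j \<and> (b = nxt n a \<or> b = prv n a) \<or> i \<noteq> j \<and> a = b)"
proof -
  have "(i, j) \<in> parcs (cycle_graph 3) \<longleftrightarrow> i < 3 \<and> j < 3 \<and> i \<noteq> j"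
    unfolding arc_cycle_graph_iff nxt_def prv_def by presburger
  moreover have "pverts (cycle_graph m) = {..<m}" for m
    by (simp add: cycle_graph_def)
  ultimately show ?thesis
    by (auto simp: cartesian_product_def arc_cycle_graph_iff)
qed

section \<open>Neighbours and distance\<close>

lemma tdist_up:
  assumes "a < n" "b < n"
  shows "tdist n (i, a) (j, b) = (if i = j then 0 else 1) + min (up n a b) (n - up n a b)"
  using up_swap[OF assms] up_less[OF assms] by (auto simp: tdist_def)

lemma tdist_cases:
  assumes "(x, y) \<in> parcs T" "v \<in> pverts T"
  obtains i a i' b where "x = (i, a)" "v = (i', b)" "a < n" "b < n" "i < 3" "i' < 3"
    "y = (i, nxt n a) \<or> y = (i, prv n a) \<or> (\<exists>j. y = (j, a) \<and> j \<noteq> i)"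
  using assms by (cases x; cases y; cases v) (auto simp: arc_iff pverts_T)

lemma tdist_arc:
  assumes "(x, y) \<in> parcs T" "v \<in> pverts T"
  shows "tdist n x v \<le> tdist n y v + 1"
proof -
  obtain i a i' b where 1: "x = (i, a)" "v = (i', b)" "a < n" "b < n"
    "y = (i, nxt n a) \<or> y = (i, prv n a) \<or> (\<exists>j. y = (j, a) \<and> j \<noteq> i)"
    using assms by (rule tdist_cases)
  note 2 = up_nxt[OF 1(3,4)] up_prv[OF 1(3,4)] up_less[OF 1(3,4)] up_eq_0[OF 1(3,4)]
  from 1(5) show ?thesis
  proof (elim disjE exE conjE)
    assume "y = (i, nxt n a)"
    then show ?thesis
      using 1(1-4) 2 by (auto simp: tdist_up nxt_less prv_less)
  next
    assume "y = (i, prv n a)"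
    then show ?thesis
      using 1(1-4) 2 by (auto simp: tdist_up nxt_less prv_less)
  next
    fix j assume "y = (j, a)"
    then show ?thesis
      using 1(1-4) by (auto simp: tdist_up nxt_less prv_less)
  qed
qed

text \<open>A move along the cycle helps only if the arc ahead is at most half the cycle, so both
  directions qualify exactly for antipodal positions. A layer change helps only if it enters the
  target layer. Every upper bound rests on this list of first steps.\<close>

lemma closer_neighbour:
  assumes "((i, a), y) \<in> parcs T" "(i', b) \<in> pverts T" "tdist n (i, a) (i', b) = tdist n y (i', b) + 1"
  shows "y = (i', a) \<and> i \<noteq> i' \<or> y = (i, nxt n a) \<and> 2 * up n a b \<le> n \<and> a \<noteq> b
    \<or> y = (i, prv n a) \<and> 2 * up n b a \<le> n \<and> a \<noteq> b"
proof -
  have 1: "a < n" "b < n" and 3: "y = (i, nxt n a) \<or> y = (i, prv n a) \<or> (\<exists>j. y = (j, a) \<and> j \<noteq> i)"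
    using tdist_cases[OF assms(1,2)] by auto
  have U: "up n a b < n" "up n a b = 0 \<longleftrightarrow> a = b" "a \<noteq> b \<Longrightarrow> up n b a = n - up n a b"
    using up_less[OF 1] up_eq_0[OF 1] up_swap[OF 1] by auto
  \<comment> \<open>\<open>r\<close> is the forward offset to the target before the move and
    \<open>s\<close> the one after it; \<open>min_eq\<close> treats a forward move,
    \<open>min_eq'\<close> a backward one.\<close>
  have min_eq: "2 * r \<le> n \<and> 0 < r" if "r < n" "min r (n - r) = min s (n - s) + 1"
    "s = (if r = 0 then n - 1 else r - 1)" for r s
    using that by (auto simp: min_def split: if_splits)
  have min_eq': "n \<le> 2 * r \<and> 0 < r" if "r < n" "min r (n - r) = min s (n - s) + 1"
    "s = (if Suc r = n then 0 else Suc r)" for r s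
    using that by (auto simp: min_def split: if_splits)
  from 3 show ?thesis
  proof (elim disjE exE conjE)
    assume y: "y = (i, nxt n a)"
    with assms(3) 1 have "min (up n a b) (n - up n a b)
      = min (up n (nxt n a) b) (n - up n (nxt n a) b) + 1"
      by (simp add: tdist_up nxt_less)
    from min_eq[OF U(1) this] U y up_nxt[OF 1] show ?thesis
      by simp
  next
    assume y: "y = (i, prv n a)"
    with assms(3) 1 have "min (up n a b) (n - up n a b)
      = min (up n (prv n a) b) (n - up n (prv n a) b) + 1"
      by (simp add: tdist_up prv_less)
    from min_eq'[OF U(1) this up_prv[OF 1]] have "n \<le> 2 * up n a b" "a \<noteq> b"
      using U(2) by auto
    with U(3) have "2 * up n b a \<le> n"
      by linarith
    with y \<open>a \<noteq> b\<close> show ?thesis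
      by simp
  next
    fix j assume "y = (j, a)" "j \<noteq> i"
    then show ?thesis
      using 1 assms(3) by (simp add: tdist_up split: if_splits)
  qed
qed

text \<open>The greedy choice: first enter the target layer, then follow a shorter arc.\<close>

lemma tdist_step:
  assumes "u \<in> pverts T" "v \<in> pverts T" "u \<noteq> v"
  shows "\<exists>y. (u, y) \<in> parcs T \<and> tdist n u v = tdist n y v + 1"
proof -
  obtain i a j b where uv: "u = (i, a)" "v = (j, b)" by fastforce
  with assms have 1: "i < 3" "j < 3" "a < n" "b < n"
    by (auto simp: pverts_T)
  consider "i \<noteq> j" | "i = j" "2 * up n a b \<le> n" | "i = j" "n \<le> 2 * up n a b"
    by linarith
  then show ?thesis
  proof cases
    case 1
    with assms show ?thesis
      by (intro exI[of _ "(j, a)"]) (auto simp: uv arc_iff pverts_T tdist_up)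
  next
    case 2
    with 1 assms(3) show ?thesis
      using up_nxt[OF 1(3,4)] up_less[OF 1(3,4)] up_eq_0[OF 1(3,4)]
      by (intro exI[of _ "(i, nxt n a)"]) (auto simp: uv arc_iff tdist_up nxt_less prv_less)
  next
    case 3
    with 1 assms(3) show ?thesis
      using up_prv[OF 1(3,4)] up_less[OF 1(3,4)] up_eq_0[OF 1(3,4)]
      by (intro exI[of _ "(i, prv n a)"]) (auto simp: uv arc_iff tdist_up nxt_less prv_less)
  qed
qed

lemma tdist_eq_0_iff: "u \<in> pverts T \<Longrightarrow> v \<in> pverts T \<Longrightarrow> tdist n u v = 0 \<longleftrightarrow> u = v"
  using up_less[of "snd u" n "snd v"] up_eq_0[of "snd u" n "snd v"]
  by (cases u; cases v) (auto simp: tdist_up pverts_T)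

section \<open>Geodesic walks\<close>

lemma tdist_le_length: "awalk u p v \<Longrightarrow> tdist n u v \<le> length p"
proof (induction p arbitrary: u)
  case Nil
  then show ?case by (simp add: awalk_Nil_iff tdist_def up_def)
next
  case (Cons e p)
  have e: "(fst e, snd e) \<in> parcs T" "fst e = u" and w: "awalk (snd e) p v"
    using Cons.prems by (auto simp: awalk_Cons_iff)
  have "v \<in> pverts T"
    using awalk_last_in_verts[OF w] by simp
  with tdist_arc e have "tdist n u v \<le> tdist n (snd e) v + 1"
    by metis
  with Cons.IH[OF w] show ?case by simp
qed

lemma tdist_walk_vert_le:
  "awalk u p v \<Longrightarrow> w \<in> set (awalk_verts u p) \<Longrightarrow> tdist n w v \<le> length p"
proof (induction p arbitrary: u)
  case Nil
  then show ?case
    using tdist_le_length[OF Nil.prems(1)] by simp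
next
  case (Cons e p)
  have w: "awalk (snd e) p v" and "fst e = u"
    using Cons.prems by (auto simp: awalk_Cons_iff)
  then consider "w = u" | "w \<in> set (awalk_verts (snd e) p)"
    using Cons.prems by auto
  then show ?case
  proof cases
    case 1
    then show ?thesis using tdist_le_length[OF Cons.prems(1)] by simp
  next
    case 2
    then show ?thesis using Cons.IH[OF w] by simp
  qed
qed

text \<open>The start cannot recur: every vertex of the remaining walk is closer to \<open>v\<close>
  than the start is, by \<open>tdist_walk_vert_le\<close>.\<close>

lemma geodesic_apath: "awalk u p v \<Longrightarrow> length p = tdist n u v \<Longrightarrow> apath u p v"
proof (induction p arbitrary: u)
  case Nil
  then show ?case by (auto simp: awalk_Nil_iff apath_Nil_iff)
next
  case (Cons e p)
  have e: "e \<in> parcs T" "fst e = u" and w: "awalk (snd e) p v"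
    using Cons.prems by (auto simp: awalk_Cons_iff)
  have v: "v \<in> pverts T"
    using awalk_last_in_verts[OF w] by simp
  have "tdist n u v \<le> tdist n (snd e) v + 1"
    using tdist_arc[of u "snd e" v] e v by (metis prod.collapse)
  with tdist_le_length[OF w] Cons.prems(2) have "length p = tdist n (snd e) v"
    by simp
  with Cons.IH[OF w] have "apath (snd e) p v"
    by simp
  moreover have "u \<notin> set (awalk_verts (snd e) p)"
    using tdist_walk_vert_le[OF w, of u] Cons.prems(2) by auto
  ultimately show ?case
    using e by (simp add: apath_Cons_iff)
qed

text \<open>A region in which greedy descent towards \<open>v\<close> never gets stuck. It replaces
  explicit arc lists: membership of \<open>u\<close> already yields a geodesic inside
  \<open>R\<close>.\<close>

definition descends :: "nat \<times> nat \<Rightarrow> (nat \<times> nat) set \<Rightarrow> bool" where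
  "descends v R \<longleftrightarrow> v \<in> pverts T \<and>
     (\<forall>x\<in>R. x \<in> pverts T \<and> (x \<noteq> v \<longrightarrow> (\<exists>y\<in>R. (x, y) \<in> parcs T \<and> tdist n x v = tdist n y v + 1)))"

lemma descends_geodesic:
  assumes R: "descends v R" and "u \<in> R"
  shows "\<exists>p. awalk u p v \<and> length p = tdist n u v \<and> set (awalk_verts u p) \<subseteq> R"
  using \<open>u \<in> R\<close>
proof (induction "tdist n u v" arbitrary: u)
  case 0
  have u: "u \<in> pverts T" and v: "v \<in> pverts T"
    using R 0(2) by (auto simp: descends_def)
  with 0(1) have "u = v"
    using tdist_eq_0_iff[OF u v] by simp
  with 0 v show ?case
    by (intro exI[of _ "[]"]) (simp add: awalk_Nil_iff)
next
  case (Suc d)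
  then have "u \<noteq> v" "u \<in> pverts T"
    using tdist_eq_0_iff[of u v] R by (auto simp: descends_def)
  with R Suc.prems obtain y where y: "y \<in> R" "(u, y) \<in> parcs T" "tdist n u v = tdist n y v + 1"
    by (auto simp: descends_def)
  with Suc(1)[of y] Suc(2) obtain p where
    "awalk y p v" "length p = tdist n y v" "set (awalk_verts y p) \<subseteq> R"
    by auto
  with y Suc.prems show ?case
    by (intro exI[of _ "(u, y) # p"]) (auto simp: awalk_Cons_iff)
qed

text \<open>Greedy descent in the whole graph attains the lower bound \<open>tdist\<close>, and
  walks attaining it are paths, so the minimum over paths is exactly \<open>tdist\<close>.\<close>

lemma shortest_path_iff:
  assumes "u \<in> pverts T" "v \<in> pverts T"
  shows "shortest_path u p v \<longleftrightarrow> awalk u p v \<and> length p = tdist n u v"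
proof -
  have "descends v (pverts T)"
    unfolding descends_def
  proof (intro conjI ballI impI assms(2))
    fix x assume "x \<in> pverts T" "x \<noteq> v"
    from tdist_step[OF this(1) assms(2) this(2)]
    show "\<exists>y\<in>pverts T. (x, y) \<in> parcs T \<and> tdist n x v = tdist n y v + 1"
      using wellformed' by blast
  qed
  from descends_geodesic[OF this assms(1)] obtain q where
    q: "awalk u q v" "length q = tdist n u v"
    by blast
  have minimal: "shortest_path u p v \<longleftrightarrow> apath u p v \<and> (\<forall>r. apath u r v \<longrightarrow> length p \<le> length r)"
    unfolding shortest_path_def is_arg_min_def by (meson not_less)
  show ?thesis
  proof
    assume "shortest_path u p v"
    then have p: "apath u p v" and "length p \<le> length q"
      using minimal geodesic_apath[OF q] by blast+
    with q tdist_le_length[OF awalkI_apath[OF p]] awalkI_apath[OF p]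
    show "awalk u p v \<and> length p = tdist n u v"
      by linarith
  next
    assume p: "awalk u p v \<and> length p = tdist n u v"
    then have "apath u p v"
      using geodesic_apath by blast
    moreover have "length p \<le> length r" if "apath u r v" for r
      using p tdist_le_length[OF awalkI_apath[OF that]] by simp
    ultimately show "shortest_path u p v"
      using minimal by blast
  qed
qed

section \<open>Criteria for fault-tolerant sets\<close>

text \<open>
  The \<open>k + 1\<close> paths are disjoint, so one of them misses \<open>Z\<close>, and it cannot leave \<open>S\<close> on its way to \<open>v\<close>.
\<close>

lemma ftmv_no_trap:
  assumes X: "ftmv_set k X" "u \<in> X" "v \<in> X" "u \<noteq> v" "(u, v) \<notin> parcs T"
    and Z: "finite Z" "card Z \<le> k"
    and S: "u \<in> S" "v \<notin> S"
    and closed: "\<And>x y. x \<in> S \<Longrightarrow> (x, y) \<in> parcs T \<Longrightarrow> tdist n x v = tdist n y v + 1 \<Longrightarrow>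
      y \<in> S \<or> y \<in> X \<union> Z \<and> y \<noteq> v"
  shows False
proof -
  have uv: "u \<in> pverts T" "v \<in> pverts T"
    using X by (auto simp: ftmv_set_def)
  obtain P where P: "card P = k + 1"
    "\<forall>p\<in>P. shortest_path u p v \<and> set (awalk_verts u p) \<inter> X = {u, v}"
    "pairwise (\<lambda>p q. set (inner_verts p) \<inter> set (inner_verts q) = {}) P"
    using X(1)[unfolded ftmv_set_def, THEN conjunct2, THEN bspec, OF X(2), THEN bspec, OF X(3),
        THEN mp, OF conjI[OF X(4,5)]]
    by (elim exE conjE) (rule that)
  have "\<exists>p\<in>P. set (inner_verts p) \<inter> Z = {}"
  proof (rule ccontr)
    assume "\<not> ?thesis"
    then have "\<forall>p\<in>P. \<exists>z. z \<in> set (inner_verts p) \<and> z \<in> Z"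
      by blast
    then obtain f where f: "\<And>p. p \<in> P \<Longrightarrow> f p \<in> set (inner_verts p) \<and> f p \<in> Z"
      by metis
    have "inj_on f P"
    proof (rule inj_onI, rule ccontr)
      fix p q assume "p \<in> P" "q \<in> P" "f p = f q" "p \<noteq> q"
      with f[of p] f[of q] pairwiseD[OF P(3), of p q] show False
        by auto
    qed
    moreover have "f ` P \<subseteq> Z"
      using f by blast
    ultimately have "card P \<le> card Z"
      using Z(1) card_inj_on_le by blast
    with P(1) Z(2) show False by simp
  qed
  then obtain p where p: "p \<in> P" "set (inner_verts p) \<inter> Z = {}"
    by blast
  with P(2) have "shortest_path u p v" and pX: "set (awalk_verts u p) \<inter> X = {u, v}"
    by blast+
  then have walk: "awalk u p v" "length p = tdist n u v"
    by (simp_all add: shortest_path_iff[OF uv])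
  have pZ: "set (awalk_verts u p) \<inter> Z \<subseteq> {u, v}"
    using set_inner_verts[OF geodesic_apath[OF walk]] p(2) by blast
  \<comment> \<open>The induction runs over suffixes of the walk; these are again geodesics to
    \<open>v\<close>, so \<open>closed\<close> applies at each step until \<open>v\<close> itself
    would lie in \<open>S\<close>.\<close>
  have "False" if "awalk x q v" "length q = tdist n x v" "x \<in> S"
    "set (awalk_verts x q) \<inter> (X \<union> Z) \<subseteq> {u, v}" for x q
    using that
  proof (induction q arbitrary: x)
    case Nil
    then show ?case using S(2) by (simp add: awalk_Nil_iff)
  next
    case (Cons e q)
    have e: "e \<in> parcs T" "fst e = x" and w: "awalk (snd e) q v"
      using Cons.prems by (auto simp: awalk_Cons_iff)
    have e': "(x, snd e) \<in> parcs T"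
      using e by (metis prod.collapse)
    have q: "length q = tdist n (snd e) v"
      using tdist_arc[OF e' uv(2)] tdist_le_length[OF w] Cons.prems(2) by simp
    have y: "snd e \<in> set (awalk_verts (snd e) q)"
      using hd_in_awalk_verts(1)[OF w] .
    have "snd e \<in> S \<or> snd e \<in> X \<union> Z \<and> snd e \<noteq> v"
      using closed[OF Cons.prems(3) e'] q Cons.prems(2) by simp
    moreover have rest: "set (awalk_verts (snd e) q) \<inter> (X \<union> Z) \<subseteq> {u, v}"
      using Cons.prems(4) by auto
    \<comment> \<open>A vertex of \<open>X\<close> or \<open>Z\<close> on the walk that differs from
      \<open>v\<close> must be \<open>u\<close>, which belongs to \<open>S\<close>.\<close>
    ultimately have "snd e \<in> S"
      using y S(1) by blast
    then show ?case
      using Cons.IH[OF w q _ rest] by blast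
  qed
  from this[OF walk S(1)] pX pZ show False by blast
qed

text \<open>Disjointness is required of regions rather than of paths: geodesics chosen in regions
  that meet only in the two ends are internally disjoint.\<close>

lemma ftmv_setI:
  assumes "X \<subseteq> pverts T"
    and "\<And>u v. u \<in> X \<Longrightarrow> v \<in> X \<Longrightarrow> u \<noteq> v \<Longrightarrow> (u, v) \<notin> parcs T \<Longrightarrow>
      \<exists>R. (\<forall>r\<le>k. u \<in> R r \<and> descends v (R r) \<and> R r \<inter> X \<subseteq> {u, v}) \<and>
          (\<forall>r\<le>k. \<forall>s\<le>k. r \<noteq> s \<longrightarrow> R r \<inter> R s \<subseteq> {u, v})"
  shows "ftmv_set k X"
  unfolding ftmv_set_def
proof (intro conjI ballI impI assms(1))
  fix u v assume u: "u \<in> X" and v: "v \<in> X" and "u \<noteq> v \<and> (u, v) \<notin> parcs T"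
  then have uv: "u \<noteq> v" "(u, v) \<notin> parcs T" "u \<in> pverts T" "v \<in> pverts T"
    using assms(1) by auto
  obtain R :: "nat \<Rightarrow> _" where R: "\<forall>r\<le>k. u \<in> R r \<and> descends v (R r) \<and> R r \<inter> X \<subseteq> {u, v}"
    "\<forall>r\<le>k. \<forall>s\<le>k. r \<noteq> s \<longrightarrow> R r \<inter> R s \<subseteq> {u, v}"
    using assms(2)[OF u v uv(1,2)] by blast
  then have "\<forall>r\<le>k. \<exists>p. awalk u p v \<and> length p = tdist n u v \<and> set (awalk_verts u p) \<subseteq> R r"
    using descends_geodesic by blast
  then obtain f where f: "\<And>r. r \<le> k \<Longrightarrow> awalk u (f r) v"
    "\<And>r. r \<le> k \<Longrightarrow> length (f r) = tdist n u v"
    "\<And>r. r \<le> k \<Longrightarrow> set (awalk_verts u (f r)) \<subseteq> R r"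
    by metis
  have inner: "set (inner_verts (f r)) = set (awalk_verts u (f r)) - {u, v}" if "r \<le> k" for r
    using set_inner_verts geodesic_apath f that by blast
  have ends: "u \<in> set (awalk_verts u (f r))" "v \<in> set (awalk_verts u (f r))" if "r \<le> k" for r
    using hd_in_awalk_verts(1)[OF f(1)[OF that]] awlast_of_awalk[OF f(1)[OF that]]
      last_in_set[OF awalk_verts_non_Nil[of u "f r"]] by simp_all
  have disj: "set (inner_verts (f r)) \<inter> set (inner_verts (f s)) = {}" if "r \<le> k" "s \<le> k" "r \<noteq> s" for r s
    using R(2) f(3) inner that by blast
  \<comment> \<open>Non-adjacent ends force an inner vertex. Hence disjoint paths with different
    indices are different, and there really are \<open>k + 1\<close> of them.\<close>
  have nonempty: "set (inner_verts (f r)) \<noteq> {}" if "r \<le> k" for r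
  proof -
    have w: "awalk u (f r) v"
      using f(1) that .
    with uv(1) have "f r \<noteq> []"
      by (auto simp: awalk_Nil_iff)
    then obtain e q where fr: "f r = e # q"
      by (cases "f r") auto
    with w have "q \<noteq> []"
      using uv(2) by (cases e) (auto simp: awalk_Cons_iff awalk_Nil_iff)
    with fr show ?thesis
      by (cases q) (auto simp: inner_verts_def)
  qed
  have "inj_on f {..k}"
  proof (rule inj_onI, rule ccontr)
    fix r s assume "r \<in> {..k}" "s \<in> {..k}" "f r = f s" "r \<noteq> s"
    with disj[of r s] nonempty[of r] show False
      by auto
  qed
  then have "card (f ` {..k}) = k + 1"
    by (simp add: card_image)
  moreover have "\<forall>p\<in>f ` {..k}. shortest_path u p v \<and> set (awalk_verts u p) \<inter> X = {u, v}"
  proof (intro ballI, elim imageE, intro conjI)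
    fix p r assume p: "p = f r" "r \<in> {..k}"
    with f uv show "shortest_path u p v"
      by (simp add: shortest_path_iff)
    from p have "u \<in> set (awalk_verts u p)" "v \<in> set (awalk_verts u p)"
      "set (awalk_verts u p) \<subseteq> R r" "R r \<inter> X \<subseteq> {u, v}"
      using ends f(3) R(1) by simp_all
    with u v show "set (awalk_verts u p) \<inter> X = {u, v}"
      by blast
  qed
  moreover have "pairwise (\<lambda>p q. set (inner_verts p) \<inter> set (inner_verts q) = {}) (f ` {..k})"
    using disj by (force simp: pairwise_def)
  ultimately show "\<exists>P. card P = k + 1 \<and>
      (\<forall>p\<in>P. shortest_path u p v \<and> set (awalk_verts u p) \<inter> X = {u, v}) \<and>
      pairwise (\<lambda>p q. set (inner_verts p) \<inter> set (inner_verts q) = {}) P"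
    by blast
qed

section \<open>Zones as descending regions\<close>

lemma tdist_nxt:
  assumes "c < n" "b < n" "c \<noteq> b" "2 * up n c b \<le> n"
  shows "tdist n (l, c) (j, b) = tdist n (l, nxt n c) (j, b) + 1"
  using assms up_nxt[OF assms(1,2)] up_eq_0[OF assms(1,2)] by (simp add: tdist_up nxt_less)

lemma tdist_prv:
  assumes "c < n" "b < n" "c \<noteq> b" "2 * up n b c \<le> n"
  shows "tdist n (l, c) (j, b) = tdist n (l, prv n c) (j, b) + 1"
  using assms up_prv[OF assms(1,2)] up_swap[OF assms(1,2)] up_less[OF assms(1,2)]
  by (auto simp: tdist_up prv_less)

lemma tdist_layer: "l \<noteq> j \<Longrightarrow> tdist n (l, c) (j, b) = tdist n (j, c) (j, b) + 1"
  by (simp add: tdist_def)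

text \<open>At offset \<open>s\<close> a vertex not yet on the target layer changes layer; every
  other vertex advances along the cycle. The half-turn condition makes each advance a gain.\<close>

lemma descends_zone_up:
  assumes "i < 3" "j < 3" and a: "a < n" and b: "b < n"
    and half: "2 * up n a b \<le> n" and s: "s \<le> up n a b"
  shows "descends (j, b) (zone_up n s (i, a) (j, b))"
  unfolding descends_def
proof (intro conjI ballI impI)
  show "(j, b) \<in> pverts T"
    using assms by (simp add: pverts_T)
next
  fix x assume "x \<in> zone_up n s (i, a) (j, b)"
  with assms(1,2) show "x \<in> pverts T"
    by (auto simp: zone_up_def pverts_T)
next
  fix x assume x: "x \<in> zone_up n s (i, a) (j, b)" "x \<noteq> (j, b)"
  obtain l c where lc: "x = (l, c)" by (cases x)
  with x have c: "c < n" and r: "l = i \<and> up n a c \<le> s \<or> l = j \<and> s \<le> up n a c \<and> up n a c \<le> up n a b"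
    by (auto simp: zone_up_def)
  with s have le: "up n a c \<le> up n a b"
    by auto
  note U = up_diff[OF a b c le]
  show "\<exists>y\<in>zone_up n s (i, a) (j, b). (x, y) \<in> parcs T \<and> tdist n x (j, b) = tdist n y (j, b) + 1"
  proof (cases "l \<noteq> j \<and> up n a c = s")
    case True
    with r lc c s assms(1,2) tdist_layer[of l j c b] show ?thesis
      by (intro bexI[of _ "(j, c)"]) (auto simp: zone_up_def arc_iff)
  next
    case False
    \<comment> \<open>At full offset the vertex would be \<open>v\<close> itself or be due for a
      layer change, and both are excluded here.\<close>
    have "up n a c \<noteq> up n a b"
    proof
      assume *: "up n a c = up n a b"
      then have "c = b" using U up_eq_0[OF c b] by simp
      with x(2) lc r s False * show False by auto
    qed
    with le have lt: "up n a c < up n a b" by simp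
    with U half up_eq_0[OF c b] have "c \<noteq> b" "2 * up n c b \<le> n"
      by auto
    note d = tdist_nxt[OF c b this, of l j]
    have "up n a (nxt n c) = Suc (up n a c)"
      using up_less_nxt[OF a c] lt up_less[OF a b] by simp
    with r lt False s have "(l, nxt n c) \<in> zone_up n s (i, a) (j, b)"
      using nxt_less[OF c] by (auto simp: zone_up_def)
    moreover have "(x, (l, nxt n c)) \<in> parcs T"
      using r assms(1,2) lc c nxt_less[OF c] by (auto simp: arc_iff)
    ultimately show ?thesis
      using d lc by blast
  qed
qed

lemma descends_zone_down:
  assumes "i < 3" "j < 3" and a: "a < n" and b: "b < n"
    and half: "2 * up n b a \<le> n" and s: "s \<le> up n b a"
  shows "descends (j, b) (zone_down n s (i, a) (j, b))"
  unfolding descends_def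
proof (intro conjI ballI impI)
  show "(j, b) \<in> pverts T"
    using assms by (simp add: pverts_T)
next
  fix x assume "x \<in> zone_down n s (i, a) (j, b)"
  with assms(1,2) show "x \<in> pverts T"
    by (auto simp: zone_down_def pverts_T)
next
  fix x assume x: "x \<in> zone_down n s (i, a) (j, b)" "x \<noteq> (j, b)"
  obtain l c where lc: "x = (l, c)" by (cases x)
  with x have c: "c < n" and r: "l = i \<and> up n c a \<le> s \<or> l = j \<and> s \<le> up n c a \<and> up n c a \<le> up n b a"
    by (auto simp: zone_down_def)
  with s have le: "up n c a \<le> up n b a"
    by auto
  note U = up_diff'[OF a b c le]
  show "\<exists>y\<in>zone_down n s (i, a) (j, b). (x, y) \<in> parcs T \<and> tdist n x (j, b) = tdist n y (j, b) + 1"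
  proof (cases "l \<noteq> j \<and> up n c a = s")
    case True
    with r lc c s assms(1,2) tdist_layer[of l j c b] show ?thesis
      by (intro bexI[of _ "(j, c)"]) (auto simp: zone_down_def arc_iff)
  next
    case False
    have "up n c a \<noteq> up n b a"
    proof
      assume *: "up n c a = up n b a"
      then have "c = b" using U up_eq_0[OF b c] by simp
      with x(2) lc r s False * show False by auto
    qed
    with le have lt: "up n c a < up n b a" by simp
    with U half up_eq_0[OF b c] have "c \<noteq> b" "2 * up n b c \<le> n"
      by auto
    note d = tdist_prv[OF c b this, of l j]
    have "up n (prv n c) a = Suc (up n c a)"
      using up_prv_right[OF a c] lt up_less[OF b a] by simp
    with r lt False s have "(l, prv n c) \<in> zone_down n s (i, a) (j, b)"
      using prv_less[OF c] by (auto simp: zone_down_def)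
    moreover have "(x, (l, prv n c)) \<in> parcs T"
      using r assms(1,2) lc c prv_less[OF c] by (auto simp: arc_iff)
    ultimately show ?thesis
      using d lc by blast
  qed
qed

lemma zone_up_start: "a < n \<Longrightarrow> (i, a) \<in> zone_up n s (i, a) v"
  by (simp add: zone_up_def up_def)

lemma zone_down_start: "a < n \<Longrightarrow> (i, a) \<in> zone_down n s (i, a) v"
  by (simp add: zone_down_def up_def)

lemma ftmv_0I:
  assumes "X \<subseteq> pverts T"
    and "\<And>u v. u \<in> X \<Longrightarrow> v \<in> X \<Longrightarrow> u \<noteq> v \<Longrightarrow> (u, v) \<notin> parcs T \<Longrightarrow> \<exists>s.
      2 * up n (snd u) (snd v) \<le> n \<and> s \<le> up n (snd u) (snd v) \<and> zone_up n s u v \<inter> X \<subseteq> {u, v} \<or>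
      2 * up n (snd v) (snd u) \<le> n \<and> s \<le> up n (snd v) (snd u) \<and> zone_down n s u v \<inter> X \<subseteq> {u, v}"
  shows "ftmv_set 0 X"
proof (rule ftmv_setI[OF assms(1)])
  fix u v assume uv: "u \<in> X" "v \<in> X" "u \<noteq> v" "(u, v) \<notin> parcs T"
  obtain i a j b where ij: "u = (i, a)" "v = (j, b)" by fastforce
  with uv assms(1) have bd: "i < 3" "j < 3" "a < n" "b < n"
    by (auto simp: pverts_T)
  from assms(2)[OF uv] obtain s where
    "2 * up n a b \<le> n \<and> s \<le> up n a b \<and> zone_up n s u v \<inter> X \<subseteq> {u, v} \<or>
     2 * up n b a \<le> n \<and> s \<le> up n b a \<and> zone_down n s u v \<inter> X \<subseteq> {u, v}"
    by (auto simp: ij)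
  then show "\<exists>R. (\<forall>r\<le>(0::nat). u \<in> R r \<and> descends v (R r) \<and> R r \<inter> X \<subseteq> {u, v}) \<and>
          (\<forall>r\<le>(0::nat). \<forall>s\<le>(0::nat). r \<noteq> s \<longrightarrow> R r \<inter> R s \<subseteq> {u, v})"
  proof (elim disjE conjE)
    assume "2 * up n a b \<le> n" "s \<le> up n a b" "zone_up n s u v \<inter> X \<subseteq> {u, v}"
    with descends_zone_up[OF bd] zone_up_start[OF bd(3)] show ?thesis
      by (intro exI[of _ "\<lambda>_. zone_up n s u v"]) (auto simp: ij)
  next
    assume "2 * up n b a \<le> n" "s \<le> up n b a" "zone_down n s u v \<inter> X \<subseteq> {u, v}"
    with descends_zone_down[OF bd] zone_down_start[OF bd(3)] show ?thesis
      by (intro exI[of _ "\<lambda>_. zone_down n s u v"]) (auto simp: ij)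
  qed
qed

lemma ftmv_1I:
  assumes "X \<subseteq> pverts T"
    and "\<And>u v. u \<in> X \<Longrightarrow> v \<in> X \<Longrightarrow> u \<noteq> v \<Longrightarrow> (u, v) \<notin> parcs T \<Longrightarrow>
      \<exists>R S. u \<in> R \<and> descends v R \<and> R \<inter> X \<subseteq> {u, v} \<and> u \<in> S \<and> descends v S \<and> S \<inter> X \<subseteq> {u, v} \<and>
        R \<inter> S \<subseteq> {u, v}"
  shows "ftmv_set 1 X"
proof (rule ftmv_setI[OF assms(1)])
  fix u v assume uv: "u \<in> X" "v \<in> X" "u \<noteq> v" "(u, v) \<notin> parcs T"
  from assms(2)[OF uv] obtain R S where
    *: "u \<in> R" "descends v R" "R \<inter> X \<subseteq> {u, v}" "u \<in> S" "descends v S" "S \<inter> X \<subseteq> {u, v}"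
      "R \<inter> S \<subseteq> {u, v}"
    by blast
  then have "S \<inter> R \<subseteq> {u, v}"
    by blast
  with * show "\<exists>R. (\<forall>r\<le>(1::nat). u \<in> R r \<and> descends v (R r) \<and> R r \<inter> X \<subseteq> {u, v}) \<and>
          (\<forall>r\<le>(1::nat). \<forall>s\<le>(1::nat). r \<noteq> s \<longrightarrow> R r \<inter> R s \<subseteq> {u, v})"
    by (intro exI[of _ "\<lambda>r. if r = 0 then R else S"]) (auto simp: le_Suc_eq)
qed

section \<open>Large fault-tolerant sets\<close>

lemma ftmv_0_product:
  assumes F: "F \<subseteq> {..<n}"
    and vis: "\<And>a b. a \<in> F \<Longrightarrow> b \<in> F \<Longrightarrow> a \<noteq> b \<Longrightarrow>
      2 \<le> up n a b \<and> (2 * up n a b \<le> n \<and> (\<forall>c\<in>F. up n a c \<le> up n a b \<longrightarrow> c = a \<or> c = b) \<or>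
        2 * up n b a \<le> n \<and> (\<forall>c\<in>F. up n c a \<le> up n b a \<longrightarrow> c = a \<or> c = b))"
  shows "ftmv_set 0 ({..<3} \<times> F)"
proof (rule ftmv_0I)
  show "{..<3} \<times> F \<subseteq> pverts T"
    using F by (auto simp: pverts_T)
next
  fix u v assume uv: "u \<in> {..<3::nat} \<times> F" "v \<in> {..<3} \<times> F" "u \<noteq> v" "(u, v) \<notin> parcs T"
  obtain i a j b where ij: "u = (i, a)" "v = (j, b)" by fastforce
  have i: "i < 3" "j < 3" "a \<in> F" "b \<in> F" "a < n"
    using uv F by (auto simp: ij)
  with uv have "a \<noteq> b"
    by (auto simp: ij arc_iff)
  with vis[of a b] vis[of b a] i have 2: "2 \<le> up n a b" "2 \<le> up n b a"
    by auto
  have diag: "up n x x = 0" for x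
    by (simp add: up_def)
  from vis[OF i(3,4) \<open>a \<noteq> b\<close>] consider
    (up) "2 * up n a b \<le> n" "\<forall>c\<in>F. up n a c \<le> up n a b \<longrightarrow> c = a \<or> c = b" |
    (down) "2 * up n b a \<le> n" "\<forall>c\<in>F. up n c a \<le> up n b a \<longrightarrow> c = a \<or> c = b"
    by blast
  then show "\<exists>s. 2 * up n (snd u) (snd v) \<le> n \<and> s \<le> up n (snd u) (snd v) \<and>
        zone_up n s u v \<inter> {..<3} \<times> F \<subseteq> {u, v} \<or>
      2 * up n (snd v) (snd u) \<le> n \<and> s \<le> up n (snd v) (snd u) \<and>
        zone_down n s u v \<inter> {..<3} \<times> F \<subseteq> {u, v}"
  proof cases
    case up
    \<comment> \<open>The layer changes one step after \<open>u\<close>. Positions of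
      \<open>F\<close> are at least two apart, so this column is free, and the columns of both ends
      are met on one layer only.\<close>
    have "zone_up n 1 u v \<inter> {..<3} \<times> F \<subseteq> {u, v}"
    proof
      fix x assume "x \<in> zone_up n 1 u v \<inter> {..<3} \<times> F"
      then have x: "x \<in> zone_up n 1 u v" "snd x \<in> F"
        by auto
      have "snd x = a \<or> snd x = b"
        using up(2) x 2 by (auto simp: zone_up_def ij)
      with x 2 show "x \<in> {u, v}"
        by (cases x) (auto simp: zone_up_def ij diag)
    qed
    with up(1) 2 show ?thesis
      by (intro exI[of _ 1] disjI1) (simp add: ij)
  next
    case down
    have "zone_down n 1 u v \<inter> {..<3} \<times> F \<subseteq> {u, v}"
    proof
      fix x assume "x \<in> zone_down n 1 u v \<inter> {..<3} \<times> F"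
      then have x: "x \<in> zone_down n 1 u v" "snd x \<in> F"
        by auto
      have "snd x = a \<or> snd x = b"
        using down(2) x 2 by (auto simp: zone_down_def ij)
      with x 2 show "x \<in> {u, v}"
        by (cases x) (auto simp: zone_down_def ij diag)
    qed
    with down(1) 2 show ?thesis
      by (intro exI[of _ 1] disjI2) (simp add: ij)
  qed
qed

lemma ftmv_nine:
  assumes "6 \<le> n"
  shows "ftmv_set 0 ({..<3} \<times> {0, n div 3, 2 * (n div 3)})"
proof -
  define m where "m = n div 3"
  \<comment> \<open>The third gap \<open>n - 2 * m\<close> is at most half the cycle because
    \<open>n\<close> is at most \<open>3 * m + 2\<close> and \<open>m\<close> is at least 2; this is
    where \<open>n\<close> must be at least 6.\<close>
  have m: "2 \<le> m" "3 * m \<le> n" "n < 3 * m + 3"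
    using assms unfolding m_def by linarith+
  have "up n 0 m = m" "up n m (2*m) = m" "up n (2*m) 0 = n - 2 * m"
    "up n 0 (2*m) = 2 * m" "up n m 0 = n - m" "up n (2*m) m = n - m"
    "up n 0 0 = 0" "up n m m = 0" "up n (2*m) (2*m) = 0"
    using m by (auto simp: up_def)
  then show ?thesis
    unfolding m_def[symmetric]
    using m by (intro ftmv_0_product) auto
qed

lemma visible_ftmv:
  assumes "\<And>u v. u \<in> X \<Longrightarrow> v \<in> X \<Longrightarrow> u \<noteq> v \<Longrightarrow> visible n X u v" "X \<subseteq> {..<3} \<times> {..<n}"
  shows "ftmv_set 0 X"
proof (rule ftmv_0I)
  show "X \<subseteq> pverts T"
    using assms(2) by (simp add: pverts_T)
next
  fix u v assume "u \<in> X" "v \<in> X" "u \<noteq> v" "(u, v) \<notin> parcs T"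
  with assms(1) have "visible n X u v"
    by blast
  then obtain s where
    "2 * up n (snd u) (snd v) \<le> n \<and> s \<le> up n (snd u) (snd v) \<and>
       (\<forall>x\<in>X. fst x = fst u \<and> up n (snd u) (snd x) \<le> s \<or>
          fst x = fst v \<and> s \<le> up n (snd u) (snd x) \<and> up n (snd u) (snd x) \<le> up n (snd u) (snd v) \<longrightarrow>
          x = u \<or> x = v) \<or>
     2 * up n (snd v) (snd u) \<le> n \<and> s \<le> up n (snd v) (snd u) \<and>
       (\<forall>x\<in>X. fst x = fst u \<and> up n (snd x) (snd u) \<le> s \<or>
          fst x = fst v \<and> s \<le> up n (snd x) (snd u) \<and> up n (snd x) (snd u) \<le> up n (snd v) (snd u) \<longrightarrow>
          x = u \<or> x = v)" (is "?A \<or> ?B")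
    unfolding visible_def by (elim bexE) (rule that)
  moreover have "zone_up n s u v \<inter> X \<subseteq> {u, v}" if ?A
    using that by (auto simp: zone_up_def)
  moreover have "zone_down n s u v \<inter> X \<subseteq> {u, v}" if ?B
    using that by (auto simp: zone_down_def)
  ultimately show "\<exists>s. 2 * up n (snd u) (snd v) \<le> n \<and> s \<le> up n (snd u) (snd v) \<and> zone_up n s u v \<inter> X \<subseteq> {u, v} \<or>
      2 * up n (snd v) (snd u) \<le> n \<and> s \<le> up n (snd v) (snd u) \<and> zone_down n s u v \<inter> X \<subseteq> {u, v}"
    by metis
qed

section \<open>Constructions for \<open>k = 1\<close>\<close>

lemma ftmv_1_even:
  assumes n: "n = 2 * h"
  shows "ftmv_set 1 ({..<3} \<times> {0, h})"
proof (rule ftmv_1I)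
  have h: "2 \<le> h" using n n_ge_3 by simp
  show "{..<3} \<times> {0, h} \<subseteq> pverts T"
    unfolding pverts_T using h n by auto
  fix u v assume uv: "u \<in> {..<3::nat} \<times> {0, h}" "v \<in> {..<3} \<times> {0, h}" "u \<noteq> v" "(u, v) \<notin> parcs T"
  obtain i a j b where ij: "u = (i, a)" "v = (j, b)" by fastforce
  have bd: "i < 3" "j < 3" "a < n" "b < n" "a \<in> {0, h}" "b \<in> {0, h}"
    using uv h n by (auto simp: ij)
  have "a \<noteq> b"
    using uv(3,4) bd(1-4) unfolding ij arc_iff by auto
  with bd n h have up_ab: "up n a b = h" "up n b a = h" and F: "{0, h} = {a, b}"
    by (auto simp: up_def)
  have diag: "up n x x = 0" for x
    by (simp add: up_def)
  \<comment> \<open>Both directions around the cycle are shortest between antipodes. In each, the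
    layer changes one step after \<open>u\<close>, which is strictly between the two columns as
    \<open>h\<close> is at least 2.\<close>
  have R: "zone_up n 1 u v \<inter> {..<3} \<times> {0, h} \<subseteq> {u, v}"
    unfolding F using h up_ab diag by (auto simp: zone_up_def ij)
  have S: "zone_down n 1 u v \<inter> {..<3} \<times> {0, h} \<subseteq> {u, v}"
    unfolding F using h up_ab diag by (auto simp: zone_down_def ij)
  have RS: "zone_up n 1 u v \<inter> zone_down n 1 u v \<subseteq> {u, v}"
  proof
    fix x assume x: "x \<in> zone_up n 1 u v \<inter> zone_down n 1 u v"
    obtain l c where lc: "x = (l, c)" by (cases x)
    with x have c: "c < n" "up n a c \<le> h" "up n c a \<le> h"
      using h up_ab by (auto simp: zone_up_def zone_down_def ij)
    show "x \<in> {u, v}"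
    proof (cases "c = a")
      case True
      with x lc diag show ?thesis by (auto simp: zone_up_def ij)
    next
      case False
      \<comment> \<open>The offsets from \<open>a\<close> to \<open>c\<close> and back add up to
        \<open>2 * h\<close> and neither exceeds \<open>h\<close>, so both equal
        \<open>h\<close>.\<close>
      with c up_swap[OF bd(3) c(1)] n have "up n a c = up n a b"
        using up_ab by auto
      then have "c = b"
        using up_inj bd c by blast
      with x lc up_ab h show ?thesis by (auto simp: zone_up_def ij)
    qed
  qed
  show "\<exists>R S. u \<in> R \<and> descends v R \<and> R \<inter> {..<3} \<times> {0, h} \<subseteq> {u, v} \<and>
    u \<in> S \<and> descends v S \<and> S \<inter> {..<3} \<times> {0, h} \<subseteq> {u, v} \<and> R \<inter> S \<subseteq> {u, v}"
    using R S RS descends_zone_up[OF bd(1-4), of 1] descends_zone_down[OF bd(1-4), of 1]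
      up_ab n h zone_up_start[OF bd(3)] zone_down_start[OF bd(3)]
    by (intro exI[of _ "zone_up n 1 u v"] exI[of _ "zone_down n 1 u v"] conjI) (simp_all add: ij)
qed

text \<open>The earliest and the latest possible layer change trace the two boundary routes of a
  rectangle, which meet only in opposite corners.\<close>

lemma zone_up_rectangle:
  assumes "i \<noteq> j" "a < n" "b < n"
  shows "zone_up n 0 (i, a) (j, b) \<inter> zone_up n (up n a b) (i, a) (j, b) \<subseteq> {(i, a), (j, b)}"
proof
  fix x assume x: "x \<in> zone_up n 0 (i, a) (j, b) \<inter> zone_up n (up n a b) (i, a) (j, b)"
  obtain l c where lc: "x = (l, c)" by (cases x)
  with x assms(1) have c: "c < n" and "l = i \<and> up n a c = 0 \<or> l = j \<and> up n a c = up n a b"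
    by (auto simp: zone_up_def)
  then show "x \<in> {(i, a), (j, b)}"
    using up_inj[OF assms(2) c assms(3)] up_eq_0[OF assms(2) c] lc by blast
qed

lemma zone_down_rectangle:
  assumes "i \<noteq> j" "a < n" "b < n"
  shows "zone_down n 0 (i, a) (j, b) \<inter> zone_down n (up n b a) (i, a) (j, b) \<subseteq> {(i, a), (j, b)}"
proof
  fix x assume x: "x \<in> zone_down n 0 (i, a) (j, b) \<inter> zone_down n (up n b a) (i, a) (j, b)"
  obtain l c where lc: "x = (l, c)" by (cases x)
  with x assms(1) have c: "c < n" and "l = i \<and> up n c a = 0 \<or> l = j \<and> up n c a = up n b a"
    by (auto simp: zone_down_def)
  then show "x \<in> {(i, a), (j, b)}"
    using up_inj'[OF assms(2) c assms(3)] up_eq_0[OF c assms(2)] lc by blast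
qed

text \<open>The assumptions on \<open>X\<close> say that the spanned rectangle is free apart from
  its two given corners, so both boundary routes are available.\<close>

lemma two_zones_up:
  assumes bd: "i < 3" "k < 3" "a < n" "b < n" and "i \<noteq> k" "2 * up n a b \<le> n"
    and X: "\<And>x. (i, x) \<in> X \<Longrightarrow> up n a x \<le> up n a b \<Longrightarrow> x = a"
      "\<And>x. (k, x) \<in> X \<Longrightarrow> up n a x \<le> up n a b \<Longrightarrow> x = b"
  shows "\<exists>R S. (i, a) \<in> R \<and> descends (k, b) R \<and> R \<inter> X \<subseteq> {(i, a), (k, b)} \<and>
    (i, a) \<in> S \<and> descends (k, b) S \<and> S \<inter> X \<subseteq> {(i, a), (k, b)} \<and> R \<inter> S \<subseteq> {(i, a), (k, b)}"
proof -
  have "zone_up n s (i, a) (k, b) \<inter> X \<subseteq> {(i, a), (k, b)}" if "s \<le> up n a b" for s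
    using X that by (auto simp: zone_up_def dest: order_trans)
  then show ?thesis
    using descends_zone_up[OF bd assms(6)] zone_up_rectangle[OF assms(5) bd(3,4)] zone_up_start[OF bd(3)]
    by (intro exI[of _ "zone_up n 0 (i, a) (k, b)"] exI[of _ "zone_up n (up n a b) (i, a) (k, b)"])
      (intro conjI; simp)
qed

lemma two_zones_down:
  assumes bd: "i < 3" "k < 3" "a < n" "b < n" and "i \<noteq> k" "2 * up n b a \<le> n"
    and X: "\<And>x. (i, x) \<in> X \<Longrightarrow> up n x a \<le> up n b a \<Longrightarrow> x = a"
      "\<And>x. (k, x) \<in> X \<Longrightarrow> up n x a \<le> up n b a \<Longrightarrow> x = b"
  shows "\<exists>R S. (i, a) \<in> R \<and> descends (k, b) R \<and> R \<inter> X \<subseteq> {(i, a), (k, b)} \<and>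
    (i, a) \<in> S \<and> descends (k, b) S \<and> S \<inter> X \<subseteq> {(i, a), (k, b)} \<and> R \<inter> S \<subseteq> {(i, a), (k, b)}"
proof -
  have "zone_down n s (i, a) (k, b) \<inter> X \<subseteq> {(i, a), (k, b)}" if "s \<le> up n b a" for s
    using X that by (auto simp: zone_down_def dest: order_trans)
  then show ?thesis
    using descends_zone_down[OF bd assms(6)] zone_down_rectangle[OF assms(5) bd(3,4)] zone_down_start[OF bd(3)]
    by (intro exI[of _ "zone_down n 0 (i, a) (k, b)"] exI[of _ "zone_down n (up n b a) (i, a) (k, b)"])
      (intro conjI; simp)
qed

text \<open>Position \<open>c\<close> is opposite to the edge between 0 and 1, at
  \<open>c - 1\<close> steps from each end. The shortest arc from \<open>c\<close> to one end of
  that edge avoids the other end, so every rectangle needed is free.\<close>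

lemma ftmv_1_odd:
  assumes n: "n = 2 * c - 1"
  shows "ftmv_set 1 {(0, 0), (0, 1), (1, c), (2, c)}"
proof -
  define X :: "(nat \<times> nat) set" where "X = {(0, 0), (0, 1), (1, c), (2, c)}"
  have c: "2 \<le> c" using n n_ge_3 by simp
  have U: "up n 1 c = c - 1" "up n c 0 = c - 1" "up n 1 0 = 2 * c - 2" "up n c 1 = c"
    "up n 0 c = c" "0 < n" "1 < n" "c < n" "2 * (c - 1) \<le> n"
    using c n by (auto simp: up_def)
  have arcs: "((1, c), (2, c)) \<in> parcs T" "((2, c), (1, c)) \<in> parcs T"
    "((0, 0), (0, 1)) \<in> parcs T" "((0, 1), (0, 0)) \<in> parcs T"
    unfolding arc_iff using U by (auto simp: nxt_def prv_def)
  have X0: "x = 0 \<or> x = 1" if "(0, x) \<in> X" for x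
    using that by (auto simp: X_def)
  have Xj: "x = c" if "(j, x) \<in> X" "0 < j" for j x
    using that by (auto simp: X_def)
  have "ftmv_set 1 X"
  proof (rule ftmv_1I)
    show "X \<subseteq> pverts T"
      unfolding pverts_T X_def using U by auto
    fix u v assume uv: "u \<in> X" "v \<in> X" "u \<noteq> v" "(u, v) \<notin> parcs T"
    have "u \<in> {(0, 0), (0, 1)} \<and> v \<in> {(1, c), (2, c)} \<or>
      v \<in> {(0, 0), (0, 1)} \<and> u \<in> {(1, c), (2, c)}"
      using uv arcs unfolding X_def by blast
    then obtain j where j: "0 < j" "j < 3" and
      *: "u = (0, 1) \<and> v = (j, c) \<or> u = (j, c) \<and> v = (0, 0) \<or>
       u = (j, c) \<and> v = (0, 1) \<or> u = (0, 0) \<and> v = (j, c)"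
      by auto
    \<comment> \<open>The route from position 1 to \<open>c\<close> and from \<open>c\<close> to 0
      is increasing; the reversed pairs use decreasing zones.\<close>
    from * show "\<exists>R S. u \<in> R \<and> descends v R \<and> R \<inter> X \<subseteq> {u, v} \<and>
      u \<in> S \<and> descends v S \<and> S \<inter> X \<subseteq> {u, v} \<and> R \<inter> S \<subseteq> {u, v}"
    proof (elim disjE conjE)
      assume "u = (0, 1)" "v = (j, c)"
      then show ?thesis
        by (simp only:) (rule two_zones_up; use c U j X0 Xj in force)
    next
      assume "u = (j, c)" "v = (0, 0)"
      then show ?thesis
        by (simp only:) (rule two_zones_up; use c U j X0 Xj in force)
    next
      assume "u = (j, c)" "v = (0, 1)"
      then show ?thesis
        by (simp only:) (rule two_zones_down; use c U j X0 Xj in force)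
    next
      assume "u = (0, 0)" "v = (j, c)"
      then show ?thesis
        by (simp only:) (rule two_zones_down; use c U j X0 Xj in force)
    qed
  qed
  then show ?thesis by (simp add: X_def)
qed

section \<open>Upper bounds\<close>

text \<open>The trap is the single start vertex: every possible first step of a geodesic lies in
  \<open>X\<close> or is deleted with \<open>Z\<close>.\<close>

lemma ftmv_blocked:
  assumes X: "ftmv_set k X" "(i, a) \<in> X" "(j, b) \<in> X" "(i, a) \<noteq> (j, b)" "((i, a), (j, b)) \<notin> parcs T"
    and Z: "finite Z" "card Z \<le> k"
    and block: "i \<noteq> j \<Longrightarrow> (j, a) \<in> X \<union> Z"
      "a \<noteq> b \<Longrightarrow> 2 * up n a b \<le> n \<Longrightarrow> (i, nxt n a) \<in> X \<union> Z"
      "a \<noteq> b \<Longrightarrow> 2 * up n b a \<le> n \<Longrightarrow> (i, prv n a) \<in> X \<union> Z"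
  shows False
proof (rule ftmv_no_trap[OF X Z, of "{(i, a)}"])
  show "(i, a) \<in> {(i, a)}" by simp
  show "(j, b) \<notin> {(i, a)}" using X(4) by auto
  fix x y assume x: "x \<in> {(i, a)}" "(x, y) \<in> parcs T" "tdist n x (j, b) = tdist n y (j, b) + 1"
  have "(j, b) \<in> pverts T"
    using X by (auto simp: ftmv_set_def)
  from closer_neighbour[of i a y, OF _ this] x block have "y \<in> X \<union> Z"
    by blast
  moreover have "y \<noteq> (j, b)"
    using x X(5) by auto
  ultimately show "y \<in> {(i, a)} \<or> y \<in> X \<union> Z \<and> y \<noteq> (j, b)"
    by blast
qed

section \<open>Local obstructions for \<open>k = 0\<close>\<close>

lemma ftmv_bounds: "ftmv_set k X \<Longrightarrow> (i, a) \<in> X \<Longrightarrow> i < 3 \<and> a < n"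
  by (auto simp: ftmv_set_def pverts_T)

lemma up_nxt_self: "a < n \<Longrightarrow> up n a (nxt n a) = 1"
  using n_ge_3 by (auto simp: up_def nxt_def)

lemma nxt_neq: "a < n \<Longrightarrow> nxt n a \<noteq> a"
  using n_ge_3 by (auto simp: nxt_def prv_def)

text \<open>Opposite corners of the square see each other only through the two other
  corners.\<close>

lemma ftmv_0_square:
  assumes X: "ftmv_set 0 X" and ij: "i \<noteq> j" and "(i, a) \<in> X" "(i, nxt n a) \<in> X" "(j, a) \<in> X" "(j, nxt n a) \<in> X"
  shows False
proof -
  have a: "a < n" using ftmv_bounds[OF X] assms by blast
  have "up n (nxt n a) a = n - 1"
    using up_swap[OF a nxt_less[OF a]] up_nxt_self[OF a] nxt_neq[OF a] by simp
  with n_ge_3 have "\<not> 2 * up n (nxt n a) a \<le> n"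
    by simp
  with assms nxt_neq[OF a] show False
    by (intro ftmv_blocked[OF X assms(3,6), of "{}"]) (auto simp: arc_iff)
qed

text \<open>Geodesics between points of one layer stay in it, and \<open>b\<close> and
  \<open>d\<close> block the two arcs from \<open>a\<close> to \<open>c\<close>. The trap is the
  open arc from \<open>d\<close> through \<open>a\<close> to \<open>b\<close>, which wraps around
  zero.\<close>

lemma ftmv_0_layer:
  assumes X: "ftmv_set 0 X" and abcd: "a < b" "b < c" "c < d" and
    mem: "(i, a) \<in> X" "(i, b) \<in> X" "(i, c) \<in> X" "(i, d) \<in> X"
  shows False
proof -
  have d: "d < n" "i < 3" using ftmv_bounds[OF X] mem by blast+
  have bd: "a < n" "c < n" using d abcd by auto
  have nadj: "((i, a), (i, c)) \<notin> parcs T"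
    unfolding arc_iff using abcd d by (auto simp: nxt_def prv_def)
  have v: "(i, c) \<in> pverts T" using d bd by (simp add: pverts_T)
  show False
  proof (rule ftmv_no_trap[OF X mem(1,3) _ nadj, of "{}" "{(i, x) | x. x < n \<and> (x < b \<or> d < x)}"])
    fix x y assume x: "x \<in> {(i, x) | x. x < n \<and> (x < b \<or> d < x)}" "(x, y) \<in> parcs T"
      "tdist n x (i, c) = tdist n y (i, c) + 1"
    then obtain z where z: "x = (i, z)" "z < n" "z < b \<or> d < z"
      by auto
    with closer_neighbour[of i z y i c] x v have "y = (i, nxt n z) \<or> y = (i, prv n z)"
      by blast
    then show "y \<in> {(i, x) | x. x < n \<and> (x < b \<or> d < x)} \<or> y \<in> X \<union> {} \<and> y \<noteq> (i, c)"
    proof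
      assume y: "y = (i, nxt n z)"
      have "nxt n z = b \<or> nxt n z < n \<and> (nxt n z < b \<or> d < nxt n z)"
        using z(2,3) abcd d by (auto simp: nxt_def)
      then show ?thesis
        using y mem abcd by auto
    next
      assume y: "y = (i, prv n z)"
      have "prv n z = d \<or> prv n z < n \<and> (prv n z < b \<or> d < prv n z)"
        using z(2,3) abcd d by (auto simp: prv_def)
      then show ?thesis
        using y mem abcd by auto
    qed
  qed (use abcd bd in auto)
qed

text \<open>A geodesic may change layer at once, so the trap consists of both vertices in column
  \<open>a\<close>; walls of two points close every useful direction.\<close>

lemma ftmv_0_parallel:
  assumes X: "ftmv_set 0 X" and "(i, a) \<in> X" "(j, b) \<in> X" and ij: "i \<noteq> j" "a \<noteq> b" "b \<noteq> nxt n a" "b \<noteq> prv n a"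
    and up: "2 * up n a b \<le> n \<Longrightarrow> (i, nxt n a) \<in> X \<and> (j, nxt n a) \<in> X"
    and down: "2 * up n b a \<le> n \<Longrightarrow> (i, prv n a) \<in> X \<and> (j, prv n a) \<in> X"
  shows False
proof -
  have v: "(j, b) \<in> pverts T" "a < n" "b < n"
    using ftmv_bounds[OF X] assms(2,3) by (auto simp: pverts_T)
  show False
  proof (rule ftmv_no_trap[OF X assms(2,3), of "{}" "{(i, a), (j, a)}"])
    fix x y assume x: "x \<in> {(i, a), (j, a)}" "(x, y) \<in> parcs T" "tdist n x (j, b) = tdist n y (j, b) + 1"
    then consider "((i, a), y) \<in> parcs T" "tdist n (i, a) (j, b) = tdist n y (j, b) + 1" |
      "((j, a), y) \<in> parcs T" "tdist n (j, a) (j, b) = tdist n y (j, b) + 1"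
      by blast
    then have "y = (j, a) \<or> (y = (i, nxt n a) \<or> y = (j, nxt n a)) \<and> 2 * up n a b \<le> n \<or>
      (y = (i, prv n a) \<or> y = (j, prv n a)) \<and> 2 * up n b a \<le> n"
      using closer_neighbour[OF _ v(1), of i a y] closer_neighbour[OF _ v(1), of j a y]
      by cases blast+
    with up down ij show "y \<in> {(i, a), (j, a)} \<or> y \<in> X \<union> {} \<and> y \<noteq> (j, b)"
      by auto
  qed (use ij in \<open>auto simp: arc_iff\<close>)
qed

section \<open>Counting by layers\<close>

lemma finite_ftmv: "ftmv_set k X \<Longrightarrow> finite X"
  by (rule finite_subset[of _ "{..<3} \<times> {..<n}"]) (auto simp: ftmv_set_def pverts_T)

lemma card_by_layers:
  assumes "ftmv_set k X"
  shows "card X = card (X `` {0}) + card (X `` {1}) + card (X `` {2})"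
proof -
  have "card (SIGMA i:{..<3}. X `` {i}) = (\<Sum>i<3. card (X `` {i}))"
    using finite_Image[OF finite_ftmv[OF assms]] by (intro card_SigmaI) auto
  moreover have "(SIGMA i:{..<3}. X `` {i}) = X"
    using ftmv_bounds[OF assms] by auto
  ultimately show ?thesis
    by (simp add: numeral_3_eq_3 numeral_2_eq_2)
qed

lemma layer_subset: "ftmv_set k X \<Longrightarrow> X `` {i} \<subseteq> {..<n}"
  using ftmv_bounds by fastforce

lemma finite_layer: "ftmv_set k X \<Longrightarrow> finite (X `` {i})"
  using finite_subset[OF layer_subset] by blast

lemma ftmv_0_card_layer:
  assumes X: "ftmv_set 0 X"
  shows "card (X `` {i}) \<le> 3"
proof (rule ccontr)
  assume "\<not> ?thesis"
  then have 4: "4 \<le> card (X `` {i})" by simp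
  define xs where "xs = sorted_list_of_set (X `` {i})"
  have len: "4 \<le> length xs" and set: "set xs = X `` {i}"
    using 4 finite_layer[OF X] by (simp_all add: xs_def)
  have "sorted_wrt (<) xs"
    unfolding xs_def by (rule strict_sorted_list_of_set)
  then have "xs ! 0 < xs ! 1" "xs ! 1 < xs ! 2" "xs ! 2 < xs ! 3"
    using len by (auto simp: sorted_wrt_iff_nth_less)
  moreover have "xs ! m \<in> X `` {i}" if "m < 4" for m
    using nth_mem[of m xs] len set that by simp
  then have "(i, xs ! 0) \<in> X" "(i, xs ! 1) \<in> X" "(i, xs ! 2) \<in> X" "(i, xs ! 3) \<in> X"
    by simp_all
  ultimately show False
    by (rule ftmv_0_layer[OF X])
qed

lemma nxt_nxt:
  assumes "p < n" "5 \<le> n"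
  shows "nxt n (nxt n p) \<noteq> p" "nxt n (nxt n p) \<noteq> nxt n p" "nxt n (nxt n p) \<noteq> prv n p"
    "\<not> 2 * up n (nxt n (nxt n p)) p \<le> n"
  using assms by (auto simp: nxt_def prv_def up_def)

lemma ftmv_0_consecutive:
  assumes X: "ftmv_set 0 X" and n: "5 \<le> n" and "(i, p) \<in> X" "(i, nxt n p) \<in> X" "(i, nxt n (nxt n p)) \<in> X"
  shows False
proof -
  have p: "p < n" using ftmv_bounds[OF X] assms by blast
  show False
    by (rule ftmv_blocked[OF X assms(3,5), of "{}"]) (use nxt_nxt[OF p n] assms in \<open>auto simp: arc_iff\<close>)
qed

lemma ftmv_0_corner:
  assumes X: "ftmv_set 0 X" and n: "5 \<le> n" and "i \<noteq> j" "(i, p) \<in> X" "(i, nxt n p) \<in> X" "(j, p) \<in> X" "(j, nxt n (nxt n p)) \<in> X"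
  shows False
proof -
  have p: "p < n" using ftmv_bounds[OF X] assms by blast
  show False
    by (rule ftmv_blocked[OF X assms(4,7), of "{}"]) (use nxt_nxt[OF p n] assms in \<open>auto simp: arc_iff\<close>)
qed

text \<open>The two points in the middle column form a wall between the ends; for \<open>n\<close>
  at least 5 the other way round is too long.\<close>

lemma ftmv_0_crossing:
  assumes X: "ftmv_set 0 X" and n: "5 \<le> n" and "i \<noteq> j" "(i, p) \<in> X" "(i, nxt n p) \<in> X" "(j, nxt n p) \<in> X" "(j, nxt n (nxt n p)) \<in> X"
  shows False
proof -
  have p: "p < n" using ftmv_bounds[OF X] assms by blast
  show False
    by (rule ftmv_0_parallel[OF X assms(4,7)]) (use nxt_nxt[OF p n] assms in \<open>auto simp: arc_iff\<close>)
qed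

text \<open>Each layer misses at most two positions, so it meets any three. Together with the local
  obstructions this is an unsatisfiable propositional problem in ten membership statements.\<close>

lemma ftmv_0_two_layers_5:
  assumes X: "ftmv_set 0 X" and n: "n = 5" and ij: "i \<noteq> j"
    and card: "3 \<le> card (X `` {i})" "3 \<le> card (X `` {j})"
  shows False
proof -
  have sub: "X `` {i} \<subseteq> {..<5}" "X `` {j} \<subseteq> {..<5}"
    using layer_subset[OF X] n by auto
  have 3: "(l, x) \<in> X \<or> (l, y) \<in> X \<or> (l, z) \<in> X"
    if "l \<in> {i, j}" "x < y" "y < z" "z < 5" for l x y z
    using three_of_five[OF sub(1) card(1), of x y z] three_of_five[OF sub(2) card(2), of x y z] that
    by auto
  have clauses: "\<not> ((l, p) \<in> X \<and> (l, nxt n p) \<in> X \<and> (l, nxt n (nxt n p)) \<in> X)"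
    "\<not> ((l, p) \<in> X \<and> (l, nxt n p) \<in> X \<and> (m, p) \<in> X \<and> (m, nxt n p) \<in> X)"
    "\<not> ((l, p) \<in> X \<and> (l, nxt n p) \<in> X \<and> (m, p) \<in> X \<and> (m, nxt n (nxt n p)) \<in> X)"
    "\<not> ((l, p) \<in> X \<and> (l, nxt n p) \<in> X \<and> (m, nxt n p) \<in> X \<and> (m, nxt n (nxt n p)) \<in> X)"
    if "l \<noteq> m" for l m p
    using n ftmv_0_consecutive[OF X] ftmv_0_square[OF X that] ftmv_0_corner[OF X _ that]
      ftmv_0_crossing[OF X _ that] by blast+
  have nxt: "nxt n 0 = 1" "nxt n 1 = 2" "nxt n 2 = 3" "nxt n 3 = 4" "nxt n 4 = 0"
    by (simp_all add: nxt_def n)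
  note c = clauses[OF ij, of 0] clauses[OF ij, of 1] clauses[OF ij, of 2] clauses[OF ij, of 3] clauses[OF ij, of 4]
    clauses[OF ij[symmetric], of 0] clauses[OF ij[symmetric], of 1] clauses[OF ij[symmetric], of 2]
    clauses[OF ij[symmetric], of 3] clauses[OF ij[symmetric], of 4]
  have t: "(l, 0) \<in> X \<or> (l, 1) \<in> X \<or> (l, 2) \<in> X" "(l, 0) \<in> X \<or> (l, 1) \<in> X \<or> (l, 3) \<in> X"
    "(l, 0) \<in> X \<or> (l, 1) \<in> X \<or> (l, 4) \<in> X" "(l, 0) \<in> X \<or> (l, 2) \<in> X \<or> (l, 3) \<in> X"
    "(l, 0) \<in> X \<or> (l, 2) \<in> X \<or> (l, 4) \<in> X" "(l, 0) \<in> X \<or> (l, 3) \<in> X \<or> (l, 4) \<in> X"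
    "(l, 1) \<in> X \<or> (l, 2) \<in> X \<or> (l, 3) \<in> X" "(l, 1) \<in> X \<or> (l, 2) \<in> X \<or> (l, 4) \<in> X"
    "(l, 1) \<in> X \<or> (l, 3) \<in> X \<or> (l, 4) \<in> X" "(l, 2) \<in> X \<or> (l, 3) \<in> X \<or> (l, 4) \<in> X"
    if "l \<in> {i, j}" for l
    using 3[OF that] by auto
  show False
    using c[unfolded nxt] t[OF insertI1] t[OF insertI2[OF singletonI]] by argo
qed

text \<open>Each layer misses at most one position. Unless both miss one and these are opposite, the
  layers share two neighbouring positions, against \<open>ftmv_0_square\<close>. In the opposite
  case the shared positions supply the walls for \<open>ftmv_0_parallel\<close>.\<close>

lemma ftmv_0_two_layers_4:
  assumes X: "ftmv_set 0 X" and n: "n = 4" and ij: "i \<noteq> j"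
    and card: "3 \<le> card (X `` {i})" "3 \<le> card (X `` {j})"
  shows False
proof -
  have sub: "X `` {i} \<subseteq> {..<4}" "X `` {j} \<subseteq> {..<4}"
    using layer_subset[OF X] n by auto
  have 2: "(l, x) \<in> X \<or> (l, y) \<in> X"
    if "l \<in> {i, j}" "x < y" "y < 4" for l x y
    using three_of_four[OF sub(1) card(1), of x y] three_of_four[OF sub(2) card(2), of x y] that
    by auto
  have par: "\<not> ((i, p) \<in> X \<and> (j, nxt n (nxt n p)) \<in> X \<and> (i, nxt n p) \<in> X \<and> (i, prv n p) \<in> X \<and>
    (j, nxt n p) \<in> X \<and> (j, prv n p) \<in> X)" for p
  proof (intro notI, elim conjE)
    assume a: "(i, p) \<in> X" "(j, nxt n (nxt n p)) \<in> X" "(i, nxt n p) \<in> X" "(i, prv n p) \<in> X"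
      "(j, nxt n p) \<in> X" "(j, prv n p) \<in> X"
    have "nxt n (nxt n p) \<noteq> p" "nxt n (nxt n p) \<noteq> nxt n p" "nxt n (nxt n p) \<noteq> prv n p"
      using ftmv_bounds[OF X a(1)] n by (auto simp: nxt_def prv_def)
    with a show False
      by (intro ftmv_0_parallel[OF X a(1,2) ij]) auto
  qed
  have nxt: "nxt n 0 = 1" "nxt n 1 = 2" "nxt n 2 = 3" "nxt n 3 = 0"
    "prv n 0 = 3" "prv n 1 = 0" "prv n 2 = 1" "prv n 3 = 2"
    by (simp_all add: nxt_def prv_def n)
  have sq: "\<not> ((i, p) \<in> X \<and> (i, nxt n p) \<in> X \<and> (j, p) \<in> X \<and> (j, nxt n p) \<in> X)" for p
    using ftmv_0_square[OF X ij] by blast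
  note c = sq[of 0] sq[of 1] sq[of 2] sq[of 3] par[of 0] par[of 1] par[of 2] par[of 3]
  have t: "(l, 0) \<in> X \<or> (l, 1) \<in> X" "(l, 0) \<in> X \<or> (l, 2) \<in> X" "(l, 0) \<in> X \<or> (l, 3) \<in> X"
    "(l, 1) \<in> X \<or> (l, 2) \<in> X" "(l, 1) \<in> X \<or> (l, 3) \<in> X" "(l, 2) \<in> X \<or> (l, 3) \<in> X"
    if "l \<in> {i, j}" for l
    using 2[OF that] by auto
  show False
    using c[unfolded nxt] t[OF insertI1] t[OF insertI2[OF singletonI]] by argo
qed

section \<open>Cardinality bounds for \<open>k = 0\<close>\<close>

lemma ftmv_0_card_le_9: "ftmv_set 0 X \<Longrightarrow> card X \<le> 9"
  using ftmv_0_card_layer[of X 0] ftmv_0_card_layer[of X 1] ftmv_0_card_layer[of X 2] card_by_layers[of 0 X]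
  by simp

lemma ftmv_0_card_le_7:
  assumes X: "ftmv_set 0 X" and n: "n = 4 \<or> n = 5"
  shows "card X \<le> 7"
proof -
  have two: "card (X `` {i}) \<le> 2 \<or> card (X `` {j}) \<le> 2" if "i \<noteq> j" for i j
    using n ftmv_0_two_layers_4[OF X _ that] ftmv_0_two_layers_5[OF X _ that] by fastforce
  show ?thesis
    using two[of 0 1] two[of 0 2] two[of 1 2] ftmv_0_card_layer[OF X, of 0] ftmv_0_card_layer[OF X, of 1]
      ftmv_0_card_layer[OF X, of 2] card_by_layers[OF X] by auto
qed

text \<open>All positions are mutually adjacent when \<open>n = 3\<close>, so by
  \<open>ftmv_0_square\<close> two layers share at most one and hold at most 3 + 1 points. Summing
  over the three pairs counts each layer twice.\<close>

lemma ftmv_0_card_le_6: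
  assumes X: "ftmv_set 0 X" and n: "n = 3"
  shows "card X \<le> 6"
proof -
  have two: "card (X `` {i}) + card (X `` {j}) \<le> 4" if "i \<noteq> j" for i j
  proof -
    have sub: "X `` {i} \<subseteq> {..<3}" "X `` {j} \<subseteq> {..<3}"
      using layer_subset[OF X] n by auto
    have inter: "a = b" if ab: "a \<in> X `` {i} \<inter> X `` {j}" "b \<in> X `` {i} \<inter> X `` {j}" for a b
    proof (rule ccontr)
      assume "a \<noteq> b"
      moreover have "a < 3" "b < 3" using ab sub by auto
      ultimately have "b = nxt n a \<or> a = nxt n b"
        unfolding nxt_def n by presburger
      with ftmv_0_square[OF X \<open>i \<noteq> j\<close>] ab show False
        by blast
    qed
    have "card (X `` {i} \<inter> X `` {j}) \<le> 1"
      using inter finite_layer[OF X] by (simp add: card_le_Suc0_iff_eq)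
    moreover have "card (X `` {i} \<union> X `` {j}) \<le> card {..<3::nat}"
      using sub by (intro card_mono) auto
    ultimately show ?thesis
      using card_Un_Int[of "X `` {i}" "X `` {j}"] finite_layer[OF X] by simp
  qed
  show ?thesis
    using two[of 0 1] two[of 0 2] two[of 1 2] card_by_layers[OF X] by simp
qed

section \<open>Bounds for \<open>k = 1\<close>\<close>

lemma ftmv_1_layer:
  assumes X: "ftmv_set 1 X" "(i, a) \<in> X" "(i, b) \<in> X" and ab: "a \<noteq> b" "b \<noteq> nxt n a" "b \<noteq> prv n a"
  shows "2 * up n a b = n" "(i, nxt n a) \<notin> X" "(i, prv n a) \<notin> X"
proof -
  have bd: "a < n" "b < n"
    using ftmv_bounds[OF X(1)] X(2,3) by blast+
  have swap: "up n b a = n - up n a b" and less: "up n a b < n"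
    using up_swap[OF bd] up_less[OF bd] ab(1) by auto
  have nadj: "(i, a) \<noteq> (i, b)" "((i, a), (i, b)) \<notin> parcs T"
    using ab by (auto simp: arc_iff)
  \<comment> \<open>Within a layer only the two cyclic neighbours can be first steps. If one is
    useless or already in \<open>X\<close>, deleting the other as \<open>z\<close> separates the
    pair.\<close>
  note blocked = ftmv_blocked[OF X nadj, of "{z}" for z, simplified]
  show half: "2 * up n a b = n"
  proof (rule ccontr)
    assume "2 * up n a b \<noteq> n"
    then consider "2 * up n a b < n" "\<not> 2 * up n b a \<le> n" | "\<not> 2 * up n a b \<le> n"
      using swap less by linarith
    then show False
      by cases (use blocked in blast)+
  qed
  show "(i, nxt n a) \<notin> X" "(i, prv n a) \<notin> X"
    using blocked by blast+
qed

text \<open>If two of three points were antipodal, the third could not be next to the first, hence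
  would be antipodal to it too and coincide with the second. So all three are pairwise adjacent,
  impossible on a cycle of length at least 4.\<close>

lemma ftmv_1_card_layer:
  assumes X: "ftmv_set 1 X" and n: "4 \<le> n"
  shows "card (X `` {i}) \<le> 2"
proof (rule ccontr)
  assume "\<not> ?thesis"
  then have "3 \<le> card (X `` {i})" by simp
  then obtain A where A: "A \<subseteq> X `` {i}" "card A = 3"
    using obtain_subset_with_card_n by metis
  then obtain a b c where abc: "A = {a, b, c}" "a \<noteq> b" "a \<noteq> c" "b \<noteq> c"
    by (auto simp: card_3_iff)
  have adj: "y = nxt n x \<or> y = prv n x"
    if x: "(i, x) \<in> X" and y: "(i, y) \<in> X" and z: "(i, z) \<in> X" and d: "x \<noteq> y" "z \<noteq> x" "z \<noteq> y" for x y z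
  proof (rule ccontr)
    assume "\<not> ?thesis"
    then have 1: "2 * up n x y = n" "(i, nxt n x) \<notin> X" "(i, prv n x) \<notin> X"
      using ftmv_1_layer[OF X x y d(1)] by blast+
    with z have "z \<noteq> nxt n x" "z \<noteq> prv n x" by auto
    with ftmv_1_layer[OF X x z] d have "2 * up n x z = n" by blast
    with 1 have "up n x y = up n x z" by simp
    with up_inj[of x n y z] ftmv_bounds[OF X] x y z d show False by blast
  qed
  have mem: "(i, a) \<in> X" "(i, b) \<in> X" "(i, c) \<in> X"
    using A abc by auto
  have "b = nxt n a \<or> b = prv n a" "c = nxt n a \<or> c = prv n a" "c = nxt n b \<or> c = prv n b"
    using adj[of a b c] adj[of a c b] adj[of b c a] mem abc(2-4) abc(2-4)[symmetric] by blast+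
  moreover have "a < n" using ftmv_bounds[OF X mem(1)] by simp
  moreover have "nxt n (nxt n a) \<noteq> prv n a" "prv n (prv n a) \<noteq> nxt n a" "nxt n (prv n a) = a" "prv n (nxt n a) = a"
    using \<open>a < n\<close> n by (auto simp: nxt_def prv_def)
  ultimately show False
    using abc by metis
qed

text \<open>With a strictly shorter direction there are only two first steps; if one is in
  \<open>X\<close>, deleting the other separates the pair.\<close>

lemma ftmv_1_rectangle:
  assumes X: "ftmv_set 1 X" "(i, a) \<in> X" "(j, b) \<in> X" and ij: "i \<noteq> j" "a \<noteq> b" and up: "2 * up n a b < n"
  shows "(i, nxt n a) \<notin> X" "(j, a) \<notin> X"
proof -
  have bd: "a < n" "b < n"
    using ftmv_bounds[OF X(1)] X(2,3) by blast+
  have down: "\<not> 2 * up n b a \<le> n"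
    using up_swap[OF bd] ij up by simp
  have nadj: "(i, a) \<noteq> (j, b)" "((i, a), (j, b)) \<notin> parcs T"
    using ij by (auto simp: arc_iff)
  show "(i, nxt n a) \<notin> X" "(j, a) \<notin> X"
    using ftmv_blocked[OF X nadj, of "{(j, a)}"] ftmv_blocked[OF X nadj, of "{(i, nxt n a)}"] down
    by auto
qed

text \<open>For odd \<open>n\<close> one direction between different columns is strictly shorter.
  Starting from the edge for which it is increasing, the first step inside the layer is occupied,
  against \<open>ftmv_1_rectangle\<close>.\<close>

lemma ftmv_1_odd_two_layers:
  assumes X: "ftmv_set 1 X" and n: "odd n" and ij: "i \<noteq> j"
    and mem: "(i, a) \<in> X" "(i, nxt n a) \<in> X" "(j, b) \<in> X" "(j, nxt n b) \<in> X"
  shows False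
proof (cases "a = b")
  case True
  have a: "a < n" using ftmv_bounds[OF X mem(1)] by simp
  have "2 * up n a (nxt n a) < n"
    using up_nxt_self[OF a] n_ge_3 by simp
  with ftmv_1_rectangle(1)[OF X mem(1) mem(4) ij] True mem nxt_neq[OF a] show False
    by auto
next
  case False
  have bd: "a < n" "b < n" using ftmv_bounds[OF X] mem by blast+
  have "2 * up n a b \<noteq> n" using n by (metis dvd_triv_left)
  moreover have "up n b a = n - up n a b"
    using up_swap[OF bd] False by simp
  ultimately consider "2 * up n a b < n" | "2 * up n b a < n"
    using up_less[OF bd] by linarith
  then show False
    using ftmv_1_rectangle(1)[OF X mem(1,3) ij False] ftmv_1_rectangle(1)[OF X mem(3,1)] ij False mem
    by cases auto
qed

lemma ftmv_1_odd_consecutive: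
  assumes X: "ftmv_set 1 X" and n: "odd n" and card: "2 \<le> card (X `` {i})"
  shows "\<exists>a. (i, a) \<in> X \<and> (i, nxt n a) \<in> X"
proof -
  obtain a b where ab: "(i, a) \<in> X" "(i, b) \<in> X" "a \<noteq> b"
    using card card_le_Suc0_iff_eq[OF finite_layer[OF X], of i] by fastforce
  have "b = nxt n a \<or> b = prv n a"
    using ftmv_1_layer(1)[OF X ab] n by (metis dvd_triv_left)
  moreover have "a = nxt n (prv n a)"
    using ftmv_bounds[OF X ab(1)] by (auto simp: nxt_def prv_def)
  ultimately show ?thesis
    using ab by metis
qed

lemma ftmv_1_card_le_4:
  assumes X: "ftmv_set 1 X" and n: "odd n"
  shows "card X \<le> 4"
proof -
  have one: "card (X `` {i}) \<le> 1 \<or> card (X `` {j}) \<le> 1" if "i \<noteq> j" for i j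
    using ftmv_1_odd_two_layers[OF X n that] ftmv_1_odd_consecutive[OF X n, of i]
      ftmv_1_odd_consecutive[OF X n, of j] by (metis Suc_1 not_less_eq_eq)
  \<comment> \<open>A layer with three points can occur only for \<open>n = 3\<close>, where it is a
    full triangle and excludes points on other layers.\<close>
  have two: "card (X `` {i}) \<le> 2 \<or> card (X `` {i}) \<le> 3 \<and> card (X `` {j}) = 0" if "i \<noteq> j" for i j
  proof (cases "n = 3")
    case False
    then show ?thesis
      using ftmv_1_card_layer[OF X] n_ge_3 by simp
  next
    case True
    have sub: "X `` {i} \<subseteq> {..<3}"
      using layer_subset[OF X] True by auto
    then have 3: "card (X `` {i}) \<le> 3"
      using card_mono[of "{..<3::nat}"] by fastforce
    have "card (X `` {j}) = 0" if "card (X `` {i}) = 3"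
    proof -
      have full: "X `` {i} = {..<3}"
        using that sub by (intro card_subset_eq) auto
      have "(j, b) \<notin> X" for b
      proof
        assume b: "(j, b) \<in> X"
        then have b3: "b < n" using ftmv_bounds[OF X] by blast
        then have "(i, nxt n b) \<in> X" "(i, b) \<in> X"
          using full nxt_less[OF b3] True by auto
        with ftmv_1_rectangle(2)[OF X b, of i "nxt n b"] \<open>i \<noteq> j\<close> nxt_neq[OF b3] up_nxt_self[OF b3] n_ge_3
        show False by auto
      qed
      then have "X `` {j} = {}" by auto
      then show ?thesis by simp
    qed
    with 3 show ?thesis by linarith
  qed
  have "card (X `` {i}) + card (X `` {j}) \<le> 3" if "i \<noteq> j" for i j
    using one[OF that] two[OF that] two[OF that[symmetric]] by linarith
  \<comment> \<open>Adding the three pairs gives twice the size of \<open>X\<close> at most 9, hence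
    at most 4 points.\<close>
  from this[of 0 1] this[of 0 2] this[of 1 2] show ?thesis
    using card_by_layers[OF X] by simp
qed

lemma ftmv_1_card_le_6:
  assumes X: "ftmv_set 1 X" and n: "4 \<le> n"
  shows "card X \<le> 6"
  using ftmv_1_card_layer[OF X n, of 0] ftmv_1_card_layer[OF X n, of 1] ftmv_1_card_layer[OF X n, of 2]
    card_by_layers[OF X] by simp

section \<open>Bounds for \<open>k\<close> at least 2\<close>

lemma ftmv_2_nonadjacent:
  assumes X: "ftmv_set k X" "(i, a) \<in> X" "(j, b) \<in> X" "(i, a) \<noteq> (j, b)" "((i, a), (j, b)) \<notin> parcs T"
    and k: "2 \<le> k"
  shows "i \<noteq> j \<and> 2 * up n a b = n"
proof (rule ccontr)
  assume neg: "\<not> ?thesis"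
  have bd: "a < n" "b < n" "i < 3" "j < 3"
    using ftmv_bounds[OF X(1)] X(2,3) by blast+
  have pair: "card {x, y} \<le> k" for x y :: "nat \<times> nat"
    using k card_insert_le_m1[of 2 "{y}" x] by (simp add: card_insert_if)
  \<comment> \<open>In each case at most two first steps remain, and a set of two deleted vertices
    covers them.\<close>
  consider "i = j" | "i \<noteq> j" "2 * up n a b < n" | "i \<noteq> j" "\<not> 2 * up n a b \<le> n"
    using neg by linarith
  then show False
  proof cases
    case 1
    with ftmv_blocked[OF X _ pair, of "(i, nxt n a)" "(i, prv n a)"] show False
      by simp
  next
    case 2
    with X(5) bd have "a \<noteq> b"
      by (auto simp: arc_iff)
    with up_swap[OF bd(1,2)] 2 have "\<not> 2 * up n b a \<le> n"
      by simp
    with ftmv_blocked[OF X _ pair, of "(j, a)" "(i, nxt n a)"] show False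
      by simp
  next
    case 3
    with ftmv_blocked[OF X _ pair, of "(j, a)" "(i, prv n a)"] show False
      by simp
  qed
qed

text \<open>Two points on one layer are adjacent. A point on another layer shares a column with or
  is antipodal to each of them, which fails for adjacent columns. Hence all of \<open>X\<close> lies
  on that layer, within one point and its two neighbours.\<close>

lemma ftmv_2_card_le_3:
  assumes X: "ftmv_set k X" and k: "2 \<le> k"
  shows "card X \<le> 3"
proof (cases "inj_on fst X")
  case True
  have "fst ` X \<subseteq> {..<3}"
    using ftmv_bounds[OF X] by auto
  then have "card (fst ` X) \<le> card {..<3::nat}"
    by (intro card_mono) auto
  with card_image[OF True] show ?thesis by simp
next
  case False
  then obtain x y where "x \<in> X" "y \<in> X" "fst x = fst y" "x \<noteq> y"
    by (auto simp: inj_on_def)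
  then obtain i a b where ab: "(i, a) \<in> X" "(i, b) \<in> X" "a \<noteq> b"
    by (metis prod.collapse)
  have adj: "y = nxt n x \<or> y = prv n x" if "(i, x) \<in> X" "(i, y) \<in> X" "x \<noteq> y" for x y
    using ftmv_2_nonadjacent[OF X that(1,2) _ _ k] that(3) by (auto simp: arc_iff)
  have bd: "a < n" "b < n" using ftmv_bounds[OF X] ab by blast+
  have up_ab: "2 * up n x y \<noteq> n" if "x = a \<and> y = b \<or> x = b \<and> y = a" for x y
  proof -
    have "up n a b = 1 \<or> up n a b = n - 1"
      using adj[OF ab] bd by (auto simp: up_def nxt_def prv_def split: if_splits)
    then show ?thesis
      using that up_swap[OF bd] ab(3) n_ge_3 by auto
  qed
  have "j = i" if jc: "(j, c) \<in> X" for j c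
  proof (rule ccontr)
    assume "j \<noteq> i"
    have anti: "2 * up n c x = n" if "(i, x) \<in> X" "c \<noteq> x" for x
      using ftmv_2_nonadjacent[OF X jc that(1) _ _ k] that(2) \<open>j \<noteq> i\<close> by (auto simp: arc_iff)
    have c: "c < n" using ftmv_bounds[OF X jc] by simp
    consider "c = a" | "c = b" | "2 * up n c a = n" "2 * up n c b = n"
      using anti ab by blast
    then show False
    proof cases
      case 1
      then show ?thesis using anti[OF ab(2)] up_ab[of a b] ab(3) by simp
    next
      case 2
      then show ?thesis using anti[OF ab(1)] up_ab[of b a] ab(3) by simp
    next
      case 3
      then show ?thesis using up_inj[OF c bd] ab(3) by simp
    qed
  qed
  then have "X \<subseteq> {(i, a), (i, nxt n a), (i, prv n a)}"
    using adj[OF ab(1)] by fast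
  then have "card X \<le> card {(i, a), (i, nxt n a), (i, prv n a)}"
    by (intro card_mono) auto
  also have "\<dots> \<le> 3"
    by (simp add: card_insert_if)
  finally show ?thesis .
qed

text \<open>A triangle has no non-adjacent pair, so the condition is vacuous for every
  \<open>k\<close>.\<close>

lemma ftmv_fibre: "ftmv_set k ({..<3} \<times> {0})"
  unfolding ftmv_set_def pverts_T using n_ge_3 by (auto simp: arc_iff)

lemma ftmv_number_eqI:
  assumes "ftmv_set k X" "card X = m" "\<And>X. ftmv_set k X \<Longrightarrow> card X \<le> m"
  shows "ftmv_number k = m"
  using ftmv_number_attained[OF pair_graph_axioms, of k] assms by (metis le_antisym)

end

theorem theorem6p4:
  fixes n k :: nat
  assumes "n \<ge> 3"
  shows "(k = 0 \<and> n \<ge> 6 \<longrightarrow>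
            pair_pre_digraph.ftmv_number (cycle_graph 3 \<box> cycle_graph n) k = 9) \<and>
         (k = 0 \<and> n \<in> {4, 5} \<longrightarrow>
            pair_pre_digraph.ftmv_number (cycle_graph 3 \<box> cycle_graph n) k = 7) \<and>
         ((k = 0 \<and> n = 3) \<or> (k = 1 \<and> even n) \<longrightarrow>
            pair_pre_digraph.ftmv_number (cycle_graph 3 \<box> cycle_graph n) k = 6) \<and>
         (k = 1 \<and> odd n \<longrightarrow>
            pair_pre_digraph.ftmv_number (cycle_graph 3 \<box> cycle_graph n) k = 4) \<and>
         (k \<ge> 2 \<longrightarrow>
            pair_pre_digraph.ftmv_number (cycle_graph 3 \<box> cycle_graph n) k = 3)"
proof -
  interpret torus n
    using assms by unfold_locales
  have nine: "ftmv_number 0 = 9" if n: "6 \<le> n"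
  proof (rule ftmv_number_eqI[OF ftmv_nine[OF n] _ ftmv_0_card_le_9])
    have "2 \<le> n div 3" using n by linarith
    then have "card {0, n div 3, 2 * (n div 3)} = 3" by simp
    then show "card ({..<3::nat} \<times> {0, n div 3, 2 * (n div 3)}) = 9"
      by (simp add: card_cartesian_product)
  qed
  have seven: "ftmv_number 0 = 7" if n: "n \<in> {4, 5}"
  proof (rule ftmv_number_eqI[OF _ _ ftmv_0_card_le_7])
    let ?X = "{(0, 0), (0, 1), (0, 3), (1, 1), (1, 3), (2, 1), (2, 3)} :: (nat \<times> nat) set"
    show "ftmv_set 0 ?X"
      using n visible_4 visible_5 by (intro visible_ftmv) auto
    show "card ?X = 7" by simp
  qed (use n in auto)
  have six_0: "ftmv_number 0 = 6" if n: "n = 3"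
  proof (rule ftmv_number_eqI[OF _ _ ftmv_0_card_le_6])
    let ?X = "{(0, 1), (0, 2), (1, 0), (1, 2), (2, 0), (2, 1)} :: (nat \<times> nat) set"
    show "ftmv_set 0 ?X"
      using n visible_3 by (intro visible_ftmv) auto
    show "card ?X = 6" by simp
  qed (use n in auto)
  have six_1: "ftmv_number 1 = 6" if "even n"
  proof -
    obtain h where h: "n = 2 * h" using \<open>even n\<close> by blast
    with assms have "2 \<le> h" by simp
    then have "card ({..<3::nat} \<times> {0, h}) = 6"
      by (simp add: card_cartesian_product)
    then show ?thesis
      using ftmv_1_even[OF h] ftmv_1_card_le_6 h \<open>2 \<le> h\<close> by (intro ftmv_number_eqI) auto
  qed
  have four: "ftmv_number 1 = 4" if "odd n"
  proof -
    \<comment> \<open>\<open>Suc n div 2\<close> is the position \<open>c\<close> opposite to the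
      edge in \<open>ftmv_1_odd\<close>.\<close>
    have n: "n = 2 * (Suc n div 2) - 1" using \<open>odd n\<close> by presburger
    show ?thesis
      by (rule ftmv_number_eqI[OF ftmv_1_odd[OF n] _ ftmv_1_card_le_4]) (use that in auto)
  qed
  have three: "ftmv_number k = 3" if "2 \<le> k"
    by (rule ftmv_number_eqI[OF ftmv_fibre _ ftmv_2_card_le_3])
      (use that in \<open>auto simp: card_cartesian_product\<close>)
  show ?thesis
    using nine seven six_0 six_1 four three by blast
qed

end
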